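(* Let $(P)$ be the problem $$(P):\quad \max\Big\{ v(\overline{OPF}_{\phi,\gamma'}) \;:\; \phi\in\mathbb{R}^{2n},\ \gamma\in\mathbb{R}^{n},\ \gamma'=(\gamma,\gamma),\ \sum_{r\in\mathcal{C}}\phi_r A_r+\mathrm{d}(\gamma')\succeq 0\Big\},$$ where $v(\overline{OPF}_{\phi,\gamma'})$ is the optimal value of $(\overline{OPF}_{\phi,\gamma'})$. Best parameters, i.e. an optimal solution $(\phi^*,\gamma'^* )$ of $(P)$, are obtained from an optimal dual solution of $(SDP)$ as follows. Let $(\phi^*,\overline{\gamma}^*,\underline{\gamma}^*,\overline{\theta}^{p*},\underline{\theta}^{p*},\overline{\theta}^{q*},\underline{\theta}^{q*},\rho^* )$ be an optimal solution of the dual $(D)$ of $(SDP)$, so that $\phi^*$ is the vector of optimal dual variables associated with the constraints $\langle A_r,X\rangle+a_r^Ty=b_r$ ($r\in\mathcal{C}$), and $\overline{\gamma}^*$, $\underline{\gamma}^*$ are the vectors of optimal dual variables associated with the constraints $X_{i,i}+X_{i+n,i+n}\le\overline{\mathbf{v}}_i$ and $-X_{i,i}-X_{i+n,i+n}\le-\underline{\mathbf{v}}_i$ ($i\in\mathcal{N}$), respectively. Then $(\phi^*,\gamma'^* )$ with $\gamma'^*=\big((\overline{\gamma}^*-\underline{\gamma}^* ),(\overline{\gamma}^*-\underline{\gamma}^* )\big)$ is an optimal solution of $(P)$. (All problems and data are as defined in the context.)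
   Context: **Data.** An electric network is a graph $(\mathcal{N},\mathcal{E})$ with $\mathcal{N}=\{1,\dots,n\}$ partitioned as $\mathcal{N}=\mathcal{N}_g\cup\mathcal{N}_d$ (generator nodes and consuming nodes); $\delta(i)$ is the set of nodes adjacent to $i$. The complex admittance matrix has entries $\mathbf{R}_{i,k}+\mathrm{j}\,\mathbf{I}_{i,k}$ for each line $(i,k)$, where $\mathrm{j}^2=-1$, and $\mathbf{R}_{i,i}=\mathbf{r}_{i,i}-\sum_{k\ne i}\mathbf{R}_{i,k}$, $\mathbf{I}_{i,i}=\mathbf{i}_{i,i}-\sum_{k\neq i}\mathbf{I}_{i,k}$ with given real shunt conductances $\mathbf{r}_{i,i}$ and susceptances $\mathbf{i}_{i,i}$. Also given are real loads $\mathbf{p}_i,\mathbf{q}_i$ ($i\in\mathcal{N}$), bounds $\underline{\mathbf{v}}_i,\overline{\mathbf{v}}_i$ ($i\in\mathcal{N}$, with $\overline{\mathbf{v}}_i\ge 0$), bounds $\underline{\mathbf{p}}_i,\overline{\mathbf{p}}_i,\underline{\mathbf{q}}_i,\overline{\mathbf{q}}_i$ ($i\in\mathcal{N}_g$), a diagonal positive semidefinite matrix $\mathbf{C}$ of order $|\mathcal{N}_g|$, and $\mathbf{c}\in\mathbb{R}^{|\mathcal{N}_g|}$. **Variables.** $x=(e,f)\in\mathbb{R}^{2n}$ (so $x_i=e_i$, $x_{i+n}=f_i$), $y=(p,q)\in\mathbb{R}^{2|\mathcal{N}_g|}$, $z=(z^e,z^f)\in\mathbb{R}^{2n}$ (so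 $z_i=z^e_i$, $z_{i+n}=z^f_i$). **Power balance equations.** For $i\in\mathcal{N}$ put $$F_i(e,f)=\mathbf{R}_{i,i}(e_i^2+f_i^2)+\sum_{k\in\delta(i)}\big[\mathbf{R}_{i,k}(e_ie_k+f_if_k)-\mathbf{I}_{i,k}(e_if_k-e_kf_i)\big],$$ $$G_i(e,f)=-\mathbf{I}_{i,i}(e_i^2+f_i^2)+\sum_{k\in\delta(i)}\big[-\mathbf{I}_{i,k}(e_ie_k+f_if_k)-\mathbf{R}_{i,k}(e_if_k-e_kf_i)\big].$$ The $2n$ power balance equations of the OPF problem are: $p_i-F_i(e,f)=\mathbf{p}_i$ and $q_i-G_i(e,f)=\mathbf{q}_i$ for $i\in\mathcal{N}_g$; $-F_i(e,f)=\mathbf{p}_i$ and $-G_i(e,f)=\mathbf{q}_i$ for $i\in\mathcal{N}_d$. They are indexed by a set $\mathcal{C}$ with $|\mathcal{C}|=2n$ and written $$\langle A_r,xx^T\rangle+a_r^Ty=b_r,\qquad r\in\mathcal{C},$$ where $A_r$ is the real symmetric $2n\times 2n$ matrix of the quadratic form in $x$ on the left-hand side of equation $r$, $a_r\in\mathbb{R}^{2|\mathcal{N}_g|}$ is the vector of coefficients of $y$, $b_r$ is the right-hand side, and $\langle M,N\rangle=\mathrm{tr}(M^TN)$. Let $\lambda_r=\lambda_{\min}(A_r)$ and $\lambda'_r=\lambda_{\min}(-A_r)$ (smallest eigenvalues). For a vector $w$, $\mathrm{d}(w)$ is the diagonal matrix with diagonal $w$. **Convex relaxation.** For $\phi\in\mathbb{R}^{2n}$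 (indexed by $\mathcal{C}$), $\gamma\in\mathbb{R}^n$ and $\gamma'=(\gamma,\gamma)\in\mathbb{R}^{2n}$, let $$h_{\phi,\gamma'}(x,y,z)=\sum_{i\in\mathcal{N}_g}\big(\mathbf{C}_{i,i}p_i^2+\mathbf{c}_ip_i\big)+\Big\langle\sum_{r\in\mathcal{C}}\phi_rA_r+\mathrm{d}(\gamma'),xx^T\Big\rangle+\sum_{r\in\mathcal{C}}\phi_r(a_r^Ty-b_r)-\gamma'^Tz.$$ With $u=(\sqrt{\overline{\mathbf{v}}},\sqrt{\overline{\mathbf{v}}})\in\mathbb{R}^{2n}$ (componentwise square roots) and $\ell=-u$, problem $(\overline{OPF}_{\phi,\gamma'})$ is: minimize $h_{\phi,\gamma'}(x,y,z)$ over $(x,y,z)\in\mathbb{R}^{2n}\times\mathbb{R}^{2|\mathcal{N}_g|}\times\mathbb{R}^{2n}$ subject to - $\underline{\mathbf{p}}_i\le p_i\le\overline{\mathbf{p}}_i$ and $\underline{\mathbf{q}}_i\le q_i\le\overline{\mathbf{q}}_i$ for $i\in\mathcal{N}_g$; - $\underline{\mathbf{v}}_i\le z_i+z_{i+n}\le\overline{\mathbf{v}}_i$ for $i\in\mathcal{N}$; - $\langle A_r,xx^T\rangle+a_r^Ty-\lambda_r\sum_{i=1}^{2n}(x_i^2-z_i)\le b_r$ for $r\in\mathcal{C}$; - $\langle -A_r,xx^T\rangle-a_r^Ty-\lambda'_r\sum_{i=1}^{2n}(x_i^2-z_i)\le -b_r$ for $r\in\mathcal{C}$; - $z_i\le(u_i+\ell_i)x_i-u_i\ell_i$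 and $z_i\ge x_i^2$ for $i=1,\dots,2n$. **Rank relaxation $(SDP)$.** Minimize $\sum_{i\in\mathcal{N}_g}(\mathbf{C}_{i,i}Y_{i,i}+\mathbf{c}_ip_i)$ over $y=(p,q)\in\mathbb{R}^{2|\mathcal{N}_g|}$, symmetric $Y$ of order $2|\mathcal{N}_g|$ (with $Y_{i,i}$, $i\in\mathcal{N}_g$, the diagonal entry corresponding to $p_i$), and symmetric $X$ of order $2n$, subject to - $\langle A_r,X\rangle+a_r^Ty=b_r$ for $r\in\mathcal{C}$; - $X_{i,i}+X_{i+n,i+n}\le\overline{\mathbf{v}}_i$ and $-X_{i,i}-X_{i+n,i+n}\le-\underline{\mathbf{v}}_i$ for $i\in\mathcal{N}$; - $\underline{\mathbf{p}}_i\le p_i\le\overline{\mathbf{p}}_i$ and $\underline{\mathbf{q}}_i\le q_i\le\overline{\mathbf{q}}_i$ for $i\in\mathcal{N}_g$; - $\begin{bmatrix}1&y^T\\ y&Y\end{bmatrix}\succeq0$ and $X\succeq0$. **Dual $(D)$ of $(SDP)$.** Maximize $$\sum_{i\in\mathcal{N}_g}\big(\underline{\theta}^p_i\underline{\mathbf{p}}_i+\underline{\theta}^q_i\underline{\mathbf{q}}_i-\overline{\theta}^p_i\overline{\mathbf{p}}_i-\overline{\theta}^q_i\overline{\mathbf{q}}_i\big)+\sum_{i\in\mathcal{N}}\big(\underline{\gamma}_i\underline{\mathbf{v}}_i-\overline{\gamma}_i\overline{\mathbf{v}}_i\big)-\sum_{r\in\mathcal{C}}\phi_rb_r-\rho$$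 over $\phi\in\mathbb{R}^{2n}$, $\rho\in\mathbb{R}$, and componentwise nonnegative $\overline{\gamma},\underline{\gamma}\in\mathbb{R}^n$, $\overline{\theta}^p,\underline{\theta}^p,\overline{\theta}^q,\underline{\theta}^q\in\mathbb{R}^{|\mathcal{N}_g|}$, subject to $$\begin{bmatrix}\rho&\tfrac12 s^T&0\\ \tfrac12 s&\widetilde{C}&0\\ 0&0&\sum_{r\in\mathcal{C}}\phi_rA_r+\mathrm{d}(\gamma')\end{bmatrix}\succeq0,\qquad s=c+\overline{\theta}-\underline{\theta}+\sum_{r\in\mathcal{C}}\phi_ra_r,$$ where $\overline{\theta}=(\overline{\theta}^p,\overline{\theta}^q)$, $\underline{\theta}=(\underline{\theta}^p,\underline{\theta}^q)$, $\gamma'=(\overline{\gamma}-\underline{\gamma},\overline{\gamma}-\underline{\gamma})$, $c=(\mathbf{c},0)\in\mathbb{R}^{2|\mathcal{N}_g|}$, and $\widetilde{C}=\begin{bmatrix}\mathbf{C}&0\\0&0\end{bmatrix}$ is of order $2|\mathcal{N}_g|$. Here $\phi,\overline{\gamma},\underline{\gamma}$ are the multipliers of the equality, upper voltage and lower voltage constraints respectively; $(\overline{\theta}^p,\underline{\theta}^p)$, $(\overline{\theta}^q,\underline{\theta}^q)$ are those of the upper/lower bounds on $p$ and $q$; and $\rho$ is associated with the top-left entry of the first semidefinite constraint. Optimal values are understood in the extended reals as the infimum (minimization) or supremum (maximization) over the feasible set. *)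

theory Defs
  imports "HOL-Analysis.Analysis"
begin

section \<open>Vectors and matrices\<close>

text \<open>
  The nodes form a finite type \<open>'n\<close>. Indices in \<open>{1..2n}\<close> are elements of \<open>'n + 'n\<close>:
  index \<open>i\<close> is \<open>Inl i\<close> and index \<open>i + n\<close> is \<open>Inr i\<close>.
\<close>

definition vpair :: "real^'a \<Rightarrow> real^'b \<Rightarrow> real^('a + 'b)" where
  "vpair v w = (\<chi> k. case k of Inl i \<Rightarrow> v $ i | Inr i \<Rightarrow> w $ i)"

definition block :: "real^'b^'a \<Rightarrow> real^'d^'a \<Rightarrow> real^'b^'c \<Rightarrow> real^'d^'c \<Rightarrow> real^('b + 'd)^('a + 'c)"
  where
  "block A B C D = (\<chi> i j.
     (case i of
        Inl i' \<Rightarrow> (case j of Inl j' \<Rightarrow> A $ i' $ j' | Inr j' \<Rightarrow> B $ i' $ j')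
      | Inr i' \<Rightarrow> (case j of Inl j' \<Rightarrow> C $ i' $ j' | Inr j' \<Rightarrow> D $ i' $ j')))"

definition diagm :: "real^'m \<Rightarrow> real^'m^'m" where
  "diagm w = (\<chi> i j. if i = j then w $ i else 0)"

definition outer :: "real^'m \<Rightarrow> real^'m^'m" where
  "outer x = (columnvector x :: real^1^'m) ** (rowvector x :: real^'m^1)"

definition minner :: "real^'m^'m \<Rightarrow> real^'m^'m \<Rightarrow> real" where
  "minner M N = trace (transpose M ** N)"

text \<open>
  Objects of order \<open>|N\<^sub>g|\<close> are stored in vectors and matrices indexed by all nodes, of which only
  the entries with indices in \<open>N\<^sub>g\<close> are ever used; in this way \<open>N\<^sub>g\<close> may be any subset of the nodes,
  the empty set included. Accordingly, \<open>psd_on S M\<close> says that the submatrix of \<open>M\<close> with rows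
  and columns in \<open>S\<close> is symmetric positive semidefinite.
\<close>

definition psd_on :: "'m set \<Rightarrow> real^'m^'m \<Rightarrow> bool" where
  "psd_on S M \<longleftrightarrow>
     (\<forall>i\<in>S. \<forall>j\<in>S. M $ i $ j = M $ j $ i) \<and>
     (\<forall>v. 0 \<le> (\<Sum>i\<in>S. \<Sum>j\<in>S. v $ i * M $ i $ j * v $ j))"

abbreviation psd :: "real^'m^'m \<Rightarrow> bool" where
  "psd \<equiv> psd_on UNIV"

definition eigenvalue :: "real^'m^'m \<Rightarrow> real \<Rightarrow> bool" where
  "eigenvalue A \<mu> \<longleftrightarrow> (\<exists>v. v \<noteq> 0 \<and> A *v v = \<mu> *\<^sub>R v)"

definition lambda_min :: "real^'m^'m \<Rightarrow> real" where
  "lambda_min A = (LEAST \<mu>. eigenvalue A \<mu>)"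

definition is_form_matrix :: "real^'m^'m \<Rightarrow> (real^'m \<Rightarrow> real) \<Rightarrow> bool" where
  "is_form_matrix A Q \<longleftrightarrow> transpose A = A \<and> (\<forall>x. x \<bullet> (A *v x) = Q x)"

definition form_matrix :: "(real^'m \<Rightarrow> real) \<Rightarrow> real^'m^'m" where
  "form_matrix Q = (THE A. is_form_matrix A Q)"


section \<open>Network data\<close>

record ('n::finite) network =
  gens :: "'n set"
  lines :: "('n \<times> 'n) set"
  Rmat :: "real^'n^'n"
  Imat :: "real^'n^'n"
  shunt_r :: "real^'n"
  shunt_i :: "real^'n"
  pload :: "real^'n"
  qload :: "real^'n"
  vlb :: "real^'n"
  vub :: "real^'n"
  plb :: "real^'n"
  pub :: "real^'n"
  qlb :: "real^'n"
  qub :: "real^'n"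
  Ccost :: "real^'n^'n"
  ccost :: "real^'n"

definition nbrs :: "'n::finite network \<Rightarrow> 'n \<Rightarrow> 'n set" where
  "nbrs N i = {k. (i, k) \<in> lines N}"

text \<open>
  The admittance matrix has entries off the diagonal only for lines; it is not required to be
  symmetric. The bounds may be inconsistent. The consuming nodes are those outside \<open>gens N\<close>.
\<close>

definition opf_network :: "'n::finite network \<Rightarrow> bool" where
  "opf_network N \<longleftrightarrow>
     sym (lines N) \<and> irrefl (lines N) \<and>
     (\<forall>i k. i \<noteq> k \<and> k \<notin> nbrs N i \<longrightarrow> Rmat N $ i $ k = 0 \<and> Imat N $ i $ k = 0) \<and>
     (\<forall>i. Rmat N $ i $ i = shunt_r N $ i - (\<Sum>k\<in>UNIV - {i}. Rmat N $ i $ k)) \<and>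
     (\<forall>i. Imat N $ i $ i = shunt_i N $ i - (\<Sum>k\<in>UNIV - {i}. Imat N $ i $ k)) \<and>
     (\<forall>i. 0 \<le> vub N $ i) \<and>
     (\<forall>i\<in>gens N. \<forall>j\<in>gens N. i \<noteq> j \<longrightarrow> Ccost N $ i $ j = 0) \<and>
     psd_on (gens N) (Ccost N)"


section \<open>Power balance equations\<close>

text \<open>Here \<open>x = (e, f)\<close>, so that \<open>e\<^sub>i = x $ Inl i\<close> and \<open>f\<^sub>i = x $ Inr i\<close>.\<close>

definition F_flow :: "'n::finite network \<Rightarrow> 'n \<Rightarrow> real^('n + 'n) \<Rightarrow> real" where
  "F_flow N i x =
     Rmat N $ i $ i * ((x $ Inl i)\<^sup>2 + (x $ Inr i)\<^sup>2)
     + (\<Sum>k\<in>nbrs N i.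
          Rmat N $ i $ k * (x $ Inl i * x $ Inl k + x $ Inr i * x $ Inr k)
          - Imat N $ i $ k * (x $ Inl i * x $ Inr k - x $ Inl k * x $ Inr i))"

definition G_flow :: "'n::finite network \<Rightarrow> 'n \<Rightarrow> real^('n + 'n) \<Rightarrow> real" where
  "G_flow N i x =
     - Imat N $ i $ i * ((x $ Inl i)\<^sup>2 + (x $ Inr i)\<^sup>2)
     + (\<Sum>k\<in>nbrs N i.
          - Imat N $ i $ k * (x $ Inl i * x $ Inl k + x $ Inr i * x $ Inr k)
          - Rmat N $ i $ k * (x $ Inl i * x $ Inr k - x $ Inl k * x $ Inr i))"

text \<open>
  The index set of the equations is \<open>'n + 'n\<close>: \<open>Inl i\<close> is the active and \<open>Inr i\<close> the reactive
  power balance at node \<open>i\<close>. Since the flow enters with a minus sign at every node, equation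
  \<open>r\<close> reads \<open>\<langle>A\<^sub>r, x x\<^sup>T\<rangle> + a\<^sub>r\<^sup>T y = b\<^sub>r\<close> with the data below.
\<close>

definition balance_form :: "'n::finite network \<Rightarrow> 'n + 'n \<Rightarrow> real^('n + 'n) \<Rightarrow> real" where
  "balance_form N r x = (case r of Inl i \<Rightarrow> - F_flow N i x | Inr i \<Rightarrow> - G_flow N i x)"

definition A_bal :: "'n::finite network \<Rightarrow> 'n + 'n \<Rightarrow> real^('n + 'n)^('n + 'n)" where
  "A_bal N r = form_matrix (balance_form N r)"

definition gen_idx :: "'n::finite network \<Rightarrow> ('n + 'n) set" where
  "gen_idx N = gens N <+> gens N"

definition a_bal :: "'n::finite network \<Rightarrow> 'n + 'n \<Rightarrow> real^('n + 'n)" where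
  "a_bal N r = (if r \<in> gen_idx N then axis r 1 else 0)"

definition b_bal :: "'n::finite network \<Rightarrow> 'n + 'n \<Rightarrow> real" where
  "b_bal N r = vpair (pload N) (qload N) $ r"

subsection \<open>The matrices of the balance equations are well defined\<close>

lemma form_matrix_unique:
  assumes "is_form_matrix A Q" "is_form_matrix B Q"
  shows "A = B"
proof -
  have sym: "M $ j $ i = M $ i $ j" if "is_form_matrix M Q" for M :: "real^'a^'a" and i j
    using that unfolding is_form_matrix_def transpose_def by (metis vec_lambda_beta)
  have ent: "axis i 1 \<bullet> (M *v axis j 1) = M $ i $ j" for M :: "real^'a^'a" and i j
    by (simp add: inner_axis' matrix_vector_mult_basis column_def)
  have pol: "2 * M $ i $ j = Q (axis i 1 + axis j 1) - Q (axis i 1) - Q (axis j 1)"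
    if "is_form_matrix M Q" for M :: "real^'a^'a" and i j
  proof -
    have q: "Q x = x \<bullet> (M *v x)" for x using that unfolding is_form_matrix_def by simp
    show ?thesis
      using sym[OF that, of i j]
      by (simp add: q ent matrix_vector_right_distrib inner_add_left inner_add_right)
  qed
  have "A $ i $ j = B $ i $ j" for i j
    using pol[OF assms(1), of i j] pol[OF assms(2), of i j] by simp
  then show ?thesis by (simp add: vec_eq_iff)
qed

lemma form_add:
  "is_form_matrix A P \<Longrightarrow> is_form_matrix B Q \<Longrightarrow> is_form_matrix (A + B) (\<lambda>x. P x + Q x)"
  unfolding is_form_matrix_def
  by (auto simp: transpose_def vec_eq_iff matrix_vector_mult_add_rdistrib inner_add_right)

lemma form_scale: "is_form_matrix A P \<Longrightarrow> is_form_matrix (c *\<^sub>R A) (\<lambda>x. c * P x)"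
  unfolding is_form_matrix_def
  by (auto simp: transpose_def vec_eq_iff scaleR_matrix_vector_assoc[symmetric])

lemma form_prod:
  fixes j k :: "'m::finite"
  shows "\<exists>A. is_form_matrix A (\<lambda>x :: real^'m. x $ j * x $ k)"
proof -
  define E :: "'m \<Rightarrow> 'm \<Rightarrow> real^'m^'m"
    where "E j k = (\<chi> a b. if a = j \<and> b = k then 1 else 0)" for j k
  have mv: "E j k *v x = x $ k *\<^sub>R axis j 1" for j k x
  proof -
    have "(\<Sum>b\<in>UNIV. (if a = j \<and> b = k then 1 else 0) * x $ b) = (if a = j then x $ k else 0)" for a
      by (cases "a = j") (simp_all add: if_distrib[of "\<lambda>t. t * _"] cong: if_cong)
    then show ?thesis
      by (simp add: E_def vec_eq_iff matrix_vector_mult_def axis_def)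
  qed
  have "is_form_matrix ((1/2) *\<^sub>R (E j k + E k j)) (\<lambda>x. x $ j * x $ k)"
    unfolding is_form_matrix_def
  proof
    show "transpose ((1/2) *\<^sub>R (E j k + E k j)) = (1/2) *\<^sub>R (E j k + E k j)"
      by (simp add: transpose_def vec_eq_iff E_def conj_commute)
    show "\<forall>x. x \<bullet> ((1/2) *\<^sub>R (E j k + E k j) *v x) = x $ j * x $ k"
      by (simp add: scaleR_matrix_vector_assoc[symmetric] matrix_vector_mult_add_rdistrib mv
          inner_add_right inner_axis)
  qed
  then show ?thesis by blast
qed

lemma form_ex_sum:
  assumes "finite S" "\<And>k. k \<in> S \<Longrightarrow> \<exists>A. is_form_matrix A (P k)"
  shows "\<exists>A. is_form_matrix A (\<lambda>x. \<Sum>k\<in>S. P k x)"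
  using assms
proof (induction S)
  case empty
  have "is_form_matrix 0 (\<lambda>x. 0)"
    by (simp add: is_form_matrix_def transpose_def vec_eq_iff)
  then show ?case by auto
next
  case (insert k S)
  then obtain A B where "is_form_matrix A (P k)" "is_form_matrix B (\<lambda>x. \<Sum>k\<in>S. P k x)"
    by blast
  from form_add[OF this] insert.hyps show ?case by auto
qed

lemma balance_form_ex: "\<exists>A. is_form_matrix A (balance_form N r)"
proof -
  let ?q = "\<lambda>P. \<exists>A. is_form_matrix A (P :: real^('a + 'a) \<Rightarrow> real)"
  have pr: "?q (\<lambda>x. x $ j * x $ k)" for j k by (rule form_prod)
  have ad: "?q (\<lambda>x. P x + Q x)" if "?q P" "?q Q" for P Q using that form_add by blast
  have sc: "?q (\<lambda>x. c * P x)" if "?q P" for P c using that form_scale by blast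
  have mi: "?q (\<lambda>x. - P x)" if "?q P" for P using sc[OF that, of "-1"] by simp
  have df: "?q (\<lambda>x. P x - Q x)" if "?q P" "?q Q" for P Q using ad[OF that(1) mi[OF that(2)]] by simp
  have "?q (\<lambda>x. - F_flow N i x)" for i
    unfolding F_flow_def power2_eq_square
    by (intro mi ad sc df pr form_ex_sum) auto
  moreover have "?q (\<lambda>x. - G_flow N i x)" for i
    unfolding G_flow_def power2_eq_square
    by (intro mi ad sc df pr form_ex_sum) auto
  ultimately show ?thesis
    by (cases r) (simp_all add: balance_form_def[abs_def])
qed

lemma A_bal_form_matrix: "is_form_matrix (A_bal N r) (balance_form N r)"
  unfolding A_bal_def form_matrix_def
  using balance_form_ex form_matrix_unique by (metis the_equality)


section \<open>The parametrised convex relaxation\<close>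

definition penalty_matrix ::
  "'n::finite network \<Rightarrow> real^('n + 'n) \<Rightarrow> real^('n + 'n) \<Rightarrow> real^('n + 'n)^('n + 'n)" where
  "penalty_matrix N \<phi> \<gamma>' = (\<Sum>r\<in>UNIV. \<phi> $ r *\<^sub>R A_bal N r) + diagm \<gamma>'"

definition h_obj ::
  "'n::finite network \<Rightarrow> real^('n + 'n) \<Rightarrow> real^('n + 'n) \<Rightarrow>
   real^('n + 'n) \<Rightarrow> real^('n + 'n) \<Rightarrow> real^('n + 'n) \<Rightarrow> real" where
  "h_obj N \<phi> \<gamma>' x y z =
     (\<Sum>i\<in>gens N. Ccost N $ i $ i * (y $ Inl i)\<^sup>2 + ccost N $ i * y $ Inl i)
     + minner (penalty_matrix N \<phi> \<gamma>') (outer x)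
     + (\<Sum>r\<in>UNIV. \<phi> $ r * (a_bal N r \<bullet> y - b_bal N r))
     - \<gamma>' \<bullet> z"

definition u_bnd :: "'n::finite network \<Rightarrow> real^('n + 'n)" where
  "u_bnd N = vpair (\<chi> i. sqrt (vub N $ i)) (\<chi> i. sqrt (vub N $ i))"

definition l_bnd :: "'n::finite network \<Rightarrow> real^('n + 'n)" where
  "l_bnd N = - u_bnd N"

definition power_bounds :: "'n::finite network \<Rightarrow> real^('n + 'n) \<Rightarrow> bool" where
  "power_bounds N y \<longleftrightarrow>
     (\<forall>i\<in>gens N. plb N $ i \<le> y $ Inl i \<and> y $ Inl i \<le> pub N $ i \<and>
                 qlb N $ i \<le> y $ Inr i \<and> y $ Inr i \<le> qub N $ i)"

definition relax_feasible ::
  "'n::finite network \<Rightarrow> ((real^('n + 'n)) \<times> (real^('n + 'n)) \<times> (real^('n + 'n))) set" where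
  "relax_feasible N = {(x, y, z).
     power_bounds N y \<and>
     (\<forall>i. vlb N $ i \<le> z $ Inl i + z $ Inr i \<and> z $ Inl i + z $ Inr i \<le> vub N $ i) \<and>
     (\<forall>r. minner (A_bal N r) (outer x) + a_bal N r \<bullet> y
          - lambda_min (A_bal N r) * (\<Sum>i\<in>UNIV. ((x $ i)\<^sup>2 - z $ i)) \<le> b_bal N r) \<and>
     (\<forall>r. minner (- A_bal N r) (outer x) - a_bal N r \<bullet> y
          - lambda_min (- A_bal N r) * (\<Sum>i\<in>UNIV. ((x $ i)\<^sup>2 - z $ i)) \<le> - b_bal N r) \<and>
     (\<forall>i. z $ i \<le> (u_bnd N $ i + l_bnd N $ i) * x $ i - u_bnd N $ i * l_bnd N $ i \<and>
          z $ i \<ge> (x $ i)\<^sup>2)}"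

definition relax_value ::
  "'n::finite network \<Rightarrow> real^('n + 'n) \<Rightarrow> real^('n + 'n) \<Rightarrow> ereal" where
  "relax_value N \<phi> \<gamma>' = (INF (x, y, z)\<in>relax_feasible N. ereal (h_obj N \<phi> \<gamma>' x y z))"

definition P_feasible :: "'n::finite network \<Rightarrow> ((real^('n + 'n)) \<times> (real^('n + 'n))) set" where
  "P_feasible N = {(\<phi>, \<gamma>'). (\<exists>\<gamma> :: real^'n. \<gamma>' = vpair \<gamma> \<gamma>) \<and> psd (penalty_matrix N \<phi> \<gamma>')}"

definition P_optimal :: "'n::finite network \<Rightarrow> (real^('n + 'n)) \<times> (real^('n + 'n)) \<Rightarrow> bool" where
  "P_optimal N = is_arg_max (\<lambda>(\<phi>, \<gamma>'). relax_value N \<phi> \<gamma>') (\<lambda>s. s \<in> P_feasible N)"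


section \<open>The rank relaxation and its dual\<close>

definition bordered :: "real \<Rightarrow> real^'m \<Rightarrow> real^'m^'m \<Rightarrow> real^(1 + 'm)^(1 + 'm)" where
  "bordered \<rho> s M = block (mat \<rho>) (rowvector s) (columnvector s) M"

text \<open>
  The primal problem is recorded because the dual variables are named after its constraints.
\<close>

definition sdp_feasible ::
  "'n::finite network \<Rightarrow>
   ((real^('n + 'n)) \<times> (real^('n + 'n)^('n + 'n)) \<times> (real^('n + 'n)^('n + 'n))) set" where
  "sdp_feasible N = {(y, Y, X).
     (\<forall>r. minner (A_bal N r) X + a_bal N r \<bullet> y = b_bal N r) \<and>
     (\<forall>i. X $ Inl i $ Inl i + X $ Inr i $ Inr i \<le> vub N $ i) \<and>
     (\<forall>i. - (X $ Inl i $ Inl i) - X $ Inr i $ Inr i \<le> - (vlb N $ i)) \<and>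
     power_bounds N y \<and>
     psd_on (UNIV <+> gen_idx N) (bordered 1 y Y) \<and>
     psd X}"

definition sdp_value :: "'n::finite network \<Rightarrow> ereal" where
  "sdp_value N = (INF (y, Y, X)\<in>sdp_feasible N.
     ereal (\<Sum>i\<in>gens N. Ccost N $ i $ i * Y $ Inl i $ Inl i + ccost N $ i * y $ Inl i))"

record ('n::finite) dual_vars =
  phi :: "real^('n + 'n)"
  gam_ub :: "real^'n"
  gam_lb :: "real^'n"
  thp_ub :: "real^'n"
  thp_lb :: "real^'n"
  thq_ub :: "real^'n"
  thq_lb :: "real^'n"
  rho :: real

definition dual_gamma :: "'n::finite dual_vars \<Rightarrow> real^('n + 'n)" where
  "dual_gamma d = vpair (gam_ub d - gam_lb d) (gam_ub d - gam_lb d)"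

definition dual_s :: "'n::finite network \<Rightarrow> 'n dual_vars \<Rightarrow> real^('n + 'n)" where
  "dual_s N d = vpair (ccost N) 0 + vpair (thp_ub d) (thq_ub d) - vpair (thp_lb d) (thq_lb d)
     + (\<Sum>r\<in>UNIV. phi d $ r *\<^sub>R a_bal N r)"

definition dual_matrix ::
  "'n::finite network \<Rightarrow> 'n dual_vars \<Rightarrow>
   real^((1 + ('n + 'n)) + ('n + 'n))^((1 + ('n + 'n)) + ('n + 'n))" where
  "dual_matrix N d =
     block (bordered (rho d) ((1/2) *\<^sub>R dual_s N d) (block (Ccost N) 0 0 0)) 0
           0 (penalty_matrix N (phi d) (dual_gamma d))"

definition dual_feasible :: "'n::finite network \<Rightarrow> 'n dual_vars set" where
  "dual_feasible N = {d.
     (\<forall>i. 0 \<le> gam_ub d $ i \<and> 0 \<le> gam_lb d $ i) \<and>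
     (\<forall>i\<in>gens N. 0 \<le> thp_ub d $ i \<and> 0 \<le> thp_lb d $ i \<and> 0 \<le> thq_ub d $ i \<and> 0 \<le> thq_lb d $ i) \<and>
     psd_on ((UNIV <+> gen_idx N) <+> UNIV) (dual_matrix N d)}"

definition dual_obj :: "'n::finite network \<Rightarrow> 'n dual_vars \<Rightarrow> real" where
  "dual_obj N d =
     (\<Sum>i\<in>gens N. thp_lb d $ i * plb N $ i + thq_lb d $ i * qlb N $ i
                - thp_ub d $ i * pub N $ i - thq_ub d $ i * qub N $ i)
     + (\<Sum>i\<in>UNIV. gam_lb d $ i * vlb N $ i - gam_ub d $ i * vub N $ i)
     - (\<Sum>r\<in>UNIV. phi d $ r * b_bal N r) - rho d"

definition dual_optimal :: "'n::finite network \<Rightarrow> 'n dual_vars \<Rightarrow> bool" where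
  "dual_optimal N = is_arg_max (dual_obj N) (\<lambda>d. d \<in> dual_feasible N)"

end

theory Submission
  imports Defs
begin

text \<open>
  Both \<open>(D)\<close> and the relaxations are compared with one feasible point \<open>(y, X)\<close> of \<open>(SDP)\<close>, where the
  cost of the point \<open>(y, y y\<^sup>T, X)\<close> is \<open>gen_cost N y\<close>. Let \<open>\<alpha>\<close> be the optimal value of \<open>(D)\<close>, attained at
  \<open>d\<close>, and let \<open>v(\<phi>, \<gamma>')\<close> be the value of the relaxation. The theorem is the chain
  \<open>v(\<phi>, \<gamma>') \<le> gen_cost N y \<le> \<alpha> \<le> v(\<phi>*, \<gamma>'*)\<close>,
  valid for all feasible parameters \<open>(\<phi>, \<gamma>')\<close>.

  The last inequality (\<open>dual_obj_le_relaxation\<close>) is weak duality. The first one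
  (\<open>relaxation_value_le_primal\<close>) holds since \<open>(0, y, diag X)\<close> is feasible for the relaxation: positive
  semidefiniteness of \<open>X\<close> gives \<open>\<lambda>\<^sub>r tr X \<le> \<langle>A\<^sub>r, X\<rangle>\<close>, and the objective at this point is the cost of
  \<open>y\<close> minus the nonnegative number \<open>\<langle>M, X\<rangle>\<close>, with \<open>M\<close> the penalty matrix.

  The middle inequality (\<open>dual_optimal_attained_by_primal\<close>) is strong duality for \<open>(SDP)\<close>. In place of
  a Slater point, it rests on compactness of the primal sublevel sets, which the voltage and power
  bounds ensure. If no suitable \<open>(y, X)\<close> existed, strict separation (\<open>convex_system_alternative\<close>) would produce
  multipliers that improve on \<open>d\<close>.
\<close>


section \<open>Positive semidefinite matrices and the least eigenvalue\<close>

lemma psd_iff: "psd M \<longleftrightarrow> transpose M = M \<and> (\<forall>v. 0 \<le> v \<bullet> (M *v v))"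
proof -
  have "(\<Sum>i\<in>UNIV. \<Sum>j\<in>UNIV. v $ i * M $ i $ j * v $ j) = v \<bullet> (M *v v)" for v
    by (simp add: inner_vec_def matrix_vector_mult_def sum_distrib_left mult.assoc)
  then show ?thesis
    by (auto simp: psd_on_def transpose_def vec_eq_iff)
qed

lemma minner_eq_inner: "minner M X = M \<bullet> X"
  unfolding minner_def trace_def inner_vec_def matrix_matrix_mult_def transpose_def
  by simp (rule sum.swap)

lemma outer_nth [simp]: "outer x $ i $ j = x $ i * x $ j"
  by (simp add: outer_def matrix_matrix_mult_def columnvector_def rowvector_def)

lemma inner_outer: "M \<bullet> outer v = v \<bullet> (M *v v)"
  by (simp add: inner_vec_def matrix_vector_mult_def sum_distrib_left algebra_simps)

lemma psd_outer: "psd (outer v)"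
proof -
  have "w \<bullet> (outer v *v w) = (v \<bullet> w)\<^sup>2" for w
    by (simp add: inner_vec_def matrix_vector_mult_def sum_distrib_left sum_distrib_right power2_eq_square algebra_simps)
  then show ?thesis
    unfolding psd_iff by (auto simp: transpose_def vec_eq_iff mult.commute)
qed

lemma symmetric_inner_commute:
  fixes M :: "real^'m^'m"
  assumes "transpose M = M"
  shows "u \<bullet> (M *v v) = v \<bullet> (M *v u)"
  using assms by (metis dot_lmul_matrix inner_commute vector_transpose_matrix)

lemma form_add_scaled:
  fixes M :: "real^'m^'m"
  assumes "transpose M = M"
  shows "(v + t *\<^sub>R u) \<bullet> (M *v (v + t *\<^sub>R u))
     = t\<^sup>2 * (u \<bullet> (M *v u)) + 2 * t * (u \<bullet> (M *v v)) + v \<bullet> (M *v v)"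
proof -
  have "M *v (v + t *\<^sub>R u) = M *v v + t *\<^sub>R (M *v u)"
    by (simp only: matrix_vector_right_distrib matrix_vector_mult_scaleR)
  then show ?thesis
    using symmetric_inner_commute[OF assms, of u v]
    by (simp add: inner_add_left inner_add_right power2_eq_square) (simp add: distrib_left)
qed

lemma nonneg_quadratic_discriminant:
  fixes a b c :: real
  assumes "0 \<le> a" "\<And>t. 0 \<le> t\<^sup>2 * a + 2 * t * b + c"
  shows "b\<^sup>2 \<le> a * c"
proof (cases "a = 0")
  case True
  have "b = 0"
  proof (rule ccontr)
    assume "b \<noteq> 0"
    then show False using assms(2)[of "- (c + 1) / (2 * b)"] True by (simp add: field_simps)
  qed
  then show ?thesis using True by simp
next
  case False
  have "0 \<le> (- b / a)\<^sup>2 * a + 2 * (- b / a) * b + c" by (rule assms)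
  also have "\<dots> = c - b\<^sup>2 / a" using False by (simp add: field_simps power2_eq_square)
  finally show ?thesis using assms(1) False by (simp add: field_simps)
qed

text \<open>
  The form is nonnegative along the line \<open>v + t u\<close>, so its discriminant in \<open>t\<close> is nonpositive.
\<close>

lemma psd_cauchy_schwarz:
  assumes "psd M"
  shows "(u \<bullet> (M *v v))\<^sup>2 \<le> (u \<bullet> (M *v u)) * (v \<bullet> (M *v v))"
proof (rule nonneg_quadratic_discriminant)
  have M: "transpose M = M" "\<And>w. 0 \<le> w \<bullet> (M *v w)" using assms by (auto simp: psd_iff)
  then show "0 \<le> u \<bullet> (M *v u)" by blast
  show "0 \<le> t\<^sup>2 * (u \<bullet> (M *v u)) + 2 * t * (u \<bullet> (M *v v)) + v \<bullet> (M *v v)" for t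
    using M(2)[of "v + t *\<^sub>R u"] by (simp only: form_add_scaled[OF M(1)])
qed

lemma psd_entries:
  assumes "psd X"
  shows "0 \<le> X $ i $ i" and "(X $ i $ j)\<^sup>2 \<le> X $ i $ i * X $ j $ j"
proof -
  have ent: "axis i 1 \<bullet> (X *v axis j 1) = X $ i $ j" for i j
    by (simp add: inner_axis' matrix_vector_mul_component inner_axis)
  show "0 \<le> X $ i $ i" using assms ent[of i i] by (metis psd_iff)
  show "(X $ i $ j)\<^sup>2 \<le> X $ i $ i * X $ j $ j"
    using psd_cauchy_schwarz[OF assms, of "axis i 1" "axis j 1"] by (simp only: ent)
qed

text \<open>
  The cone of positive semidefinite matrices lies in its own dual. Symmetric Gaussian elimination
  writes \<open>X\<close> as a nonnegative combination of matrices \<open>w w\<^sup>T\<close>, and \<open>\<langle>M, w w\<^sup>T\<rangle> = w\<^sup>T M w \<ge> 0\<close>. The induction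
  counts the nonzero diagonal entries, one of which disappears with each pivot.
\<close>

lemma psd_inner_nonneg:
  assumes "psd M" "psd X"
  shows "0 \<le> M \<bullet> X"
  using assms(2)
proof (induction "card {i. X $ i $ i \<noteq> 0}" arbitrary: X rule: less_induct)
  case less
  have symX: "transpose X = X" and posX: "\<And>v. 0 \<le> v \<bullet> (X *v v)"
    using less.prems by (auto simp: psd_iff)
  have ent: "axis i 1 \<bullet> (X *v v) = (X $ i) \<bullet> v" for i v
    by (simp add: inner_axis' matrix_vector_mul_component)
  have ent2: "axis i 1 \<bullet> (X *v axis j 1) = X $ i $ j" for i j
    by (simp add: ent inner_axis)
  have cs: "(X $ i \<bullet> v)\<^sup>2 \<le> X $ i $ i * (v \<bullet> (X *v v))" for i v
    using psd_cauchy_schwarz[OF less.prems, of "axis i 1" v] unfolding ent by (simp add: inner_axis)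
  show ?case
  proof (cases "\<exists>i. X $ i $ i \<noteq> 0")
    case False
    have "X $ i $ j = 0" for i j
      using cs[of i "axis j 1"] False by (simp add: inner_axis)
    then have "X = 0" by (simp add: vec_eq_iff)
    then show ?thesis by simp
  next
    case True
    then obtain i where "X $ i $ i \<noteq> 0" by blast
    then have i: "X $ i $ i > 0" using posX[of "axis i 1"] by (simp add: ent2)
    \<comment> \<open>Eliminating the pivot \<open>i\<close> leaves the Schur complement, bordered by a zero row and column.\<close>
    define Z where "Z = X - (1 / X $ i $ i) *\<^sub>R outer (X $ i)"
    have symij: "X $ j $ k = X $ k $ j" for j k
      using symX by (metis transpose_def vec_lambda_beta)
    have Zform: "v \<bullet> (Z *v v) = v \<bullet> (X *v v) - (X $ i \<bullet> v)\<^sup>2 / X $ i $ i" for v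
    proof -
      have "v \<bullet> (Z *v v) = Z \<bullet> outer v" by (simp add: inner_outer)
      also have "\<dots> = X \<bullet> outer v - (1 / X $ i $ i) * (outer (X $ i) \<bullet> outer v)"
        by (simp add: Z_def inner_diff_left)
      also have "outer (X $ i) \<bullet> outer v = (X $ i \<bullet> v)\<^sup>2"
        by (simp add: inner_vec_def sum_distrib_left sum_distrib_right power2_eq_square algebra_simps)
      finally show ?thesis by (simp add: inner_outer)
    qed
    have "psd Z"
      unfolding psd_iff
    proof
      show "transpose Z = Z" by (simp add: Z_def transpose_def vec_eq_iff symij)
      show "\<forall>v. 0 \<le> v \<bullet> (Z *v v)"
        unfolding Zform using cs[of i] i by (simp add: field_simps)
    qed
    have "Z $ j $ j = 0" if "X $ j $ j = 0" for j
    proof -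
      have "X $ i $ j = 0"
        using cs[of j "axis i 1"] that symij[of i j] by (simp add: inner_axis)
      then show ?thesis using that by (simp add: Z_def)
    qed
    then have "{j. Z $ j $ j \<noteq> 0} \<subseteq> {j. X $ j $ j \<noteq> 0}" by blast
    moreover have "i \<in> {j. X $ j $ j \<noteq> 0} - {j. Z $ j $ j \<noteq> 0}" using i by (simp add: Z_def)
    ultimately have "{j. Z $ j $ j \<noteq> 0} \<subset> {j. X $ j $ j \<noteq> 0}" by blast
    then have "card {j. Z $ j $ j \<noteq> 0} < card {j. X $ j $ j \<noteq> 0}"
      by (intro psubset_card_mono) auto
    then have "0 \<le> M \<bullet> Z" using less.hyps \<open>psd Z\<close> by blast
    moreover have "0 \<le> M \<bullet> outer (X $ i)" using assms(1) by (simp add: inner_outer psd_iff)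
    moreover have "M \<bullet> X = M \<bullet> Z + (1 / X $ i $ i) * (M \<bullet> outer (X $ i))"
      by (simp add: Z_def inner_diff_right)
    ultimately show ?thesis using i by simp
  qed
qed

text \<open>
  The Rayleigh quotient attains its minimum on the unit sphere, and a minimiser is an eigenvector.
  Hence a least eigenvalue exists, and it is the minimum of the quotient.
\<close>

lemma psd_minus_lambda_min:
  fixes A :: "real^'m^'m"
  assumes sym: "transpose A = A"
  shows "psd (A - lambda_min A *\<^sub>R mat 1)"
proof -
  let ?S = "sphere (0::real^'m) 1"
  have "axis undefined 1 \<in> ?S" by simp
  then have "?S \<noteq> {}" by blast
  moreover have "continuous_on ?S (\<lambda>v. v \<bullet> (A *v v))"
    by (intro continuous_intros linear_continuous_on matrix_vector_mul_bounded_linear)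
  ultimately obtain v where v: "v \<in> ?S" and min: "\<And>w. w \<in> ?S \<Longrightarrow> v \<bullet> (A *v v) \<le> w \<bullet> (A *v w)"
    using continuous_attains_inf[of ?S "\<lambda>v. v \<bullet> (A *v v)"] by auto
  define m where "m = v \<bullet> (A *v v)"
  define B where "B = A - m *\<^sub>R mat 1"
  have B: "B *v w = A *v w - m *\<^sub>R w" for w
    by (simp add: B_def matrix_vector_mult_diff_rdistrib scaleR_matrix_vector_assoc[symmetric])
  have vv: "v \<bullet> v = 1" using v by (simp add: dot_square_norm)
  have psdB: "psd B"
    unfolding psd_iff
  proof (intro conjI allI)
    have "transpose (mat 1 :: real^'m^'m) = mat 1" by (rule transpose_mat)
    then show "transpose B = B" using sym by (simp add: B_def transpose_def vec_eq_iff)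
    fix w :: "real^'m"
    show "0 \<le> w \<bullet> (B *v w)"
    proof (cases "w = 0")
      case False
      let ?w = "(1 / norm w) *\<^sub>R w"
      have "m \<le> ?w \<bullet> (A *v ?w)" unfolding m_def using False by (intro min) simp
      also have "\<dots> = (w \<bullet> (A *v w)) / (w \<bullet> w)"
        by (simp add: matrix_vector_mult_scaleR dot_square_norm power2_eq_square)
      finally have "m * (w \<bullet> w) \<le> w \<bullet> (A *v w)"
        using False by (simp add: field_simps)
      then show ?thesis by (simp add: B inner_diff_right)
    qed simp
  qed
  \<comment> \<open>The minimiser is isotropic for the positive semidefinite form \<open>B\<close>, hence in its kernel.\<close>
  have "v \<bullet> (B *v v) = 0" by (simp add: B inner_diff_right vv m_def)
  then have "((B *v v) \<bullet> (B *v v))\<^sup>2 \<le> 0"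
    using psd_cauchy_schwarz[OF psdB, of "B *v v" v] by simp
  then have "A *v v = m *\<^sub>R v" by (simp add: B)
  moreover have "v \<noteq> 0" using vv by auto
  ultimately have "eigenvalue A m" unfolding eigenvalue_def by blast
  moreover have "m \<le> \<mu>" if \<mu>: "eigenvalue A \<mu>" for \<mu>
  proof -
    obtain w where w: "w \<noteq> 0" "A *v w = \<mu> *\<^sub>R w"
      using \<mu> by (auto simp: eigenvalue_def)
    have "0 \<le> w \<bullet> (B *v w)" using psdB by (simp add: psd_iff)
    also have "\<dots> = (\<mu> - m) * (w \<bullet> w)"
      unfolding B w(2) by (simp add: inner_diff_right left_diff_distrib)
    finally have "0 \<le> (\<mu> - m) * (w \<bullet> w)" .
    moreover have "w \<bullet> w > 0" using w(1) by simp
    ultimately show ?thesis by (simp add: zero_le_mult_iff)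
  qed
  ultimately have "lambda_min A = m" unfolding lambda_min_def by (intro Least_equality)
  then show ?thesis using psdB by (simp add: B_def)
qed

lemma lambda_min_trace_le_inner:
  assumes "transpose A = A" "psd X"
  shows "lambda_min A * (\<Sum>i\<in>UNIV. X $ i $ i) \<le> A \<bullet> X"
proof -
  have "mat 1 \<bullet> X = (\<Sum>i\<in>UNIV. X $ i $ i)"
    by (simp add: inner_vec_def mat_def if_distrib[of "\<lambda>t. t * _"] cong: if_cong)
  then show ?thesis
    using psd_inner_nonneg[OF psd_minus_lambda_min[OF assms(1)] assms(2)]
    by (simp add: inner_diff_left)
qed


section \<open>A theorem of the alternative for convex systems\<close>

text \<open>
  A theorem of the alternative: an unsolvable convex system has multipliers that certify a positive
  gap. The certificate is a hyperplane separating \<open>0\<close> from the set of residual vectors that are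
  attained or exceeded on \<open>\<Omega>\<close>. The boundedness hypothesis replaces a constraint qualification: it
  keeps \<open>0\<close> out of the closure of that set, so that the separation is strict.
\<close>

lemma convex_system_alternative:
  fixes \<Omega> :: "'a::euclidean_space set"
    and g :: "'k::finite \<Rightarrow> 'a \<Rightarrow> real" and l :: "'r::finite \<Rightarrow> 'a \<Rightarrow> real" and \<beta> :: "'r \<Rightarrow> real"
  assumes ne: "\<Omega> \<noteq> {}" and "closed \<Omega>" "convex \<Omega>"
    and g_convex: "\<And>k. convex_on \<Omega> (g k)" and g_cont: "\<And>k. continuous_on \<Omega> (g k)"
    and lin: "\<And>r. linear (l r)"
    and bdd: "bounded {p \<in> \<Omega>. (\<forall>k. g k p \<le> 1) \<and> (\<forall>r. \<bar>l r p - \<beta> r\<bar> \<le> 1)}"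
    and none: "\<not> (\<exists>p\<in>\<Omega>. (\<forall>k. g k p \<le> 0) \<and> (\<forall>r. l r p = \<beta> r))"
  obtains \<mu> \<delta> \<phi> where "\<And>k. 0 \<le> \<mu> $ k" "0 < \<delta>"
    "\<And>p. p \<in> \<Omega> \<Longrightarrow> \<delta> \<le> (\<Sum>k\<in>UNIV. \<mu> $ k * g k p) + (\<Sum>r\<in>UNIV. \<phi> $ r * (l r p - \<beta> r))"
proof -
  define S where "S = {(a :: real^'k, b :: real^'r).
      \<exists>p\<in>\<Omega>. (\<forall>k. g k p \<le> a $ k) \<and> (\<forall>r. l r p - \<beta> r = b $ r)}"
  have "convex S"
    unfolding convex_def
  proof (intro ballI allI impI)
    fix s s' and u v :: real
    assume s: "s \<in> S" "s' \<in> S" and uv: "0 \<le> u" "0 \<le> v" "u + v = 1"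
    obtain a b a' b' where ab: "s = (a, b)" "s' = (a', b')" by (metis surj_pair)
    obtain p p' where p: "p \<in> \<Omega>" "\<forall>k. g k p \<le> a $ k" "\<forall>r. l r p - \<beta> r = b $ r"
      and p': "p' \<in> \<Omega>" "\<forall>k. g k p' \<le> a' $ k" "\<forall>r. l r p' - \<beta> r = b' $ r"
      using s unfolding ab S_def by auto
    let ?q = "u *\<^sub>R p + v *\<^sub>R p'"
    have "?q \<in> \<Omega>" using \<open>convex \<Omega>\<close> p(1) p'(1) uv by (simp add: convexD)
    moreover have "g k ?q \<le> u * a $ k + v * a' $ k" for k
    proof -
      have "g k ?q \<le> u * g k p + v * g k p'"
        using g_convex[of k] p(1) p'(1) uv unfolding convex_on_def by blast
      also have "\<dots> \<le> u * a $ k + v * a' $ k"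
        using p(2) p'(2) uv by (intro add_mono mult_left_mono) auto
      finally show ?thesis .
    qed
    moreover have "l r ?q - \<beta> r = u * b $ r + v * b' $ r" for r
    proof -
      have "\<beta> r = u * \<beta> r + v * \<beta> r" using uv by (metis distrib_right mult_1)
      moreover have "l r ?q = u * l r p + v * l r p'"
        using lin[of r] by (simp add: linear_add linear_scale)
      ultimately show ?thesis using p(3) p'(3) by (simp flip: p(3)[rule_format] p'(3)[rule_format] add: algebra_simps)
    qed
    ultimately show "u *\<^sub>R s + v *\<^sub>R s' \<in> S"
      unfolding ab S_def by auto
  qed
  let ?K = "{p \<in> \<Omega>. (\<forall>k. g k p \<le> 1) \<and> (\<forall>r. \<bar>l r p - \<beta> r\<bar> \<le> 1)}"
  have l_cont: "continuous_on T (l r)" for T r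
    using lin[of r] by (simp add: linear_continuous_on linear_conv_bounded_linear)
  \<comment> \<open>A sequence in \<open>S\<close> tending to \<open>0\<close> comes from points of the bounded sublevel set; a limit
    point of these would solve the system.\<close>
  have "0 \<notin> closure S"
  proof
    assume "0 \<in> closure S"
    then obtain s where s: "\<And>n. s n \<in> S" "s \<longlonglongrightarrow> 0"
      unfolding closure_sequential by blast
    have "\<exists>p. p \<in> \<Omega> \<and> (\<forall>k. g k p \<le> fst (s n) $ k) \<and> (\<forall>r. l r p - \<beta> r = snd (s n) $ r)" for n
      using s(1)[of n] unfolding S_def by (auto simp: case_prod_beta)
    then obtain p where p: "\<And>n. p n \<in> \<Omega>" "\<And>n k. g k (p n) \<le> fst (s n) $ k"
        "\<And>n r. l r (p n) - \<beta> r = snd (s n) $ r"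
      by metis
    have lim: "(\<lambda>n. fst (s n) $ k) \<longlonglongrightarrow> 0" "(\<lambda>n. snd (s n) $ r) \<longlonglongrightarrow> 0" for k r
      using tendsto_vec_nth[OF tendsto_fst[OF s(2)], of k] tendsto_vec_nth[OF tendsto_snd[OF s(2)], of r]
      by simp_all
    obtain n0 where n0: "\<And>n. n \<ge> n0 \<Longrightarrow> norm (s n) < 1"
      using LIMSEQ_D[OF s(2), of 1] by auto
    have "p (n + n0) \<in> ?K" for n
    proof -
      have "norm (s (n + n0)) < 1" by (simp add: n0)
      then have "norm (fst (s (n + n0))) \<le> 1" "norm (snd (s (n + n0))) \<le> 1"
        using norm_fst_le[of "fst (s (n + n0))" "snd (s (n + n0))"]
          norm_snd_le[of "snd (s (n + n0))" "fst (s (n + n0))"] by simp_all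
      then have "\<bar>fst (s (n + n0)) $ k\<bar> \<le> 1" "\<bar>snd (s (n + n0)) $ r\<bar> \<le> 1" for k r
        using component_le_norm_cart order_trans by blast+
      then show ?thesis
        using p(1)[of "n + n0"] p(2)[of _ "n + n0"] p(3)[of _ "n + n0"]
        by (auto intro: order_trans[OF _ abs_le_D1])
    qed
    moreover have "bounded (range (\<lambda>n. p (n + n0)))"
      by (rule bounded_subset[OF bdd]) (use calculation in blast)
    ultimately obtain q w where w: "strict_mono w" "((\<lambda>n. p (n + n0)) \<circ> w) \<longlonglongrightarrow> q"
      using bounded_imp_convergent_subsequence by metis
    have pq: "(\<lambda>n. p (w n + n0)) \<longlonglongrightarrow> q" using w(2) by (simp add: o_def)
    have q: "q \<in> \<Omega>" using closed_sequentially[OF \<open>closed \<Omega>\<close> _ pq] p(1) by simp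
    have sub: "strict_mono (\<lambda>n. w n + n0)" using w(1) by (simp add: strict_mono_def)
    have "g k q \<le> 0" for k
    proof (rule LIMSEQ_le)
      show "(\<lambda>n. g k (p (w n + n0))) \<longlonglongrightarrow> g k q"
        using continuous_on_tendsto_compose[OF g_cont pq q] p(1) by simp
      show "(\<lambda>n. fst (s (w n + n0)) $ k) \<longlonglongrightarrow> 0"
        using LIMSEQ_subseq_LIMSEQ[OF lim(1) sub] by (simp add: o_def)
      show "\<exists>N. \<forall>n\<ge>N. g k (p (w n + n0)) \<le> fst (s (w n + n0)) $ k" using p(2) by blast
    qed
    moreover have "l r q = \<beta> r" for r
    proof -
      have "(\<lambda>n. l r (p (w n + n0)) - \<beta> r) \<longlonglongrightarrow> l r q - \<beta> r"
        using continuous_on_tendsto_compose[OF l_cont[of UNIV r] pq] by (intro tendsto_diff) auto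
      moreover have "(\<lambda>n. l r (p (w n + n0)) - \<beta> r) \<longlonglongrightarrow> 0"
        unfolding p(3) using LIMSEQ_subseq_LIMSEQ[OF lim(2) sub] by (simp add: o_def)
      ultimately show ?thesis using LIMSEQ_unique by fastforce
    qed
    ultimately show False using none q by blast
  qed
  then obtain m \<delta> where m: "0 < \<delta>" "\<And>s. s \<in> closure S \<Longrightarrow> m \<bullet> s > \<delta>"
    using separating_hyperplane_closed_0[of "closure S"] \<open>convex S\<close>
    by (auto intro: convex_closure)
  obtain \<mu> \<phi> where m_eq: "m = (\<mu>, \<phi>)" by fastforce
  have sep: "\<delta> < \<mu> \<bullet> a + \<phi> \<bullet> b" if "(a, b) \<in> S" for a b
    using m(2)[OF subsetD[OF closure_subset that]] by (simp add: m_eq)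
  have in_S: "((\<chi> k. g k p + c k), (\<chi> r. l r p - \<beta> r)) \<in> S" if "p \<in> \<Omega>" "\<And>k. 0 \<le> c k" for p c
    unfolding S_def using that by (auto intro!: bexI[of _ p])
  show thesis
  proof
    show "0 < \<delta>" by fact
    show "\<delta> \<le> (\<Sum>k\<in>UNIV. \<mu> $ k * g k p) + (\<Sum>r\<in>UNIV. \<phi> $ r * (l r p - \<beta> r))" if "p \<in> \<Omega>" for p
      using sep[OF in_S[OF that, of "\<lambda>_. 0"]] by (simp add: inner_vec_def)
    \<comment> \<open>\<open>S\<close> is upward closed in its first component, so a negative multiplier would make the
      separating functional unbounded below on \<open>S\<close>.\<close>
    show "0 \<le> \<mu> $ k" for k
    proof (rule ccontr)
      assume neg: "\<not> 0 \<le> \<mu> $ k"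
      obtain p where p: "p \<in> \<Omega>" using ne by blast
      define B where "B = (\<Sum>k\<in>UNIV. \<mu> $ k * g k p) + (\<Sum>r\<in>UNIV. \<phi> $ r * (l r p - \<beta> r))"
      define c where "c = \<bar>B\<bar> / (- \<mu> $ k)"
      have "c \<ge> 0" using neg by (simp add: c_def divide_nonneg_neg field_simps)
      then have "\<delta> < \<mu> \<bullet> (\<chi> j. g j p + (if j = k then c else 0)) + \<phi> \<bullet> (\<chi> r. l r p - \<beta> r)"
        by (intro sep in_S p) auto
      also have "\<dots> = B + \<mu> $ k * c"
        by (simp add: inner_vec_def B_def distrib_left sum.distrib if_distrib[of "\<lambda>t. _ * t"] cong: if_cong)
      also have "\<mu> $ k * c = - \<bar>B\<bar>" using neg by (simp add: c_def divide_nonneg_neg field_simps)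
      finally show False using \<open>0 < \<delta>\<close> by simp
    qed
  qed
qed


section \<open>The Lagrangian and the dual constraints\<close>

lemma psd_on_block_diagonal:
  "psd_on (S <+> T) (block A 0 0 B) \<longleftrightarrow> psd_on S A \<and> psd_on T B"
proof -
  have form: "(\<Sum>i\<in>S <+> T. \<Sum>j\<in>S <+> T. v $ i * block A 0 0 B $ i $ j * v $ j)
      = (\<Sum>i\<in>S. \<Sum>j\<in>S. v $ Inl i * A $ i $ j * v $ Inl j)
      + (\<Sum>i\<in>T. \<Sum>j\<in>T. v $ Inr i * B $ i $ j * v $ Inr j)" for v
    by (simp add: sum.Plus block_def)
  have sym: "(\<forall>i\<in>S <+> T. \<forall>j\<in>S <+> T. block A 0 0 B $ i $ j = block A 0 0 B $ j $ i)
      \<longleftrightarrow> (\<forall>i\<in>S. \<forall>j\<in>S. A $ i $ j = A $ j $ i) \<and> (\<forall>i\<in>T. \<forall>j\<in>T. B $ i $ j = B $ j $ i)"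
    unfolding ball_simps Plus_def by (simp add: ball_Un block_def)
  show ?thesis
  proof
    assume psd: "psd_on (S <+> T) (block A 0 0 B)"
    then have nonneg: "0 \<le> (\<Sum>i\<in>S. \<Sum>j\<in>S. v $ Inl i * A $ i $ j * v $ Inl j)
      + (\<Sum>i\<in>T. \<Sum>j\<in>T. v $ Inr i * B $ i $ j * v $ Inr j)" for v
      unfolding psd_on_def form by blast
    have "0 \<le> (\<Sum>i\<in>S. \<Sum>j\<in>S. w $ i * A $ i $ j * w $ j)" for w
      using nonneg[of "vpair w 0"] by (simp add: vpair_def)
    moreover have "0 \<le> (\<Sum>i\<in>T. \<Sum>j\<in>T. w $ i * B $ i $ j * w $ j)" for w
      using nonneg[of "vpair 0 w"] by (simp add: vpair_def)
    ultimately show "psd_on S A \<and> psd_on T B"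
      using psd sym unfolding psd_on_def by blast
  next
    assume psd: "psd_on S A \<and> psd_on T B"
    have "0 \<le> (\<Sum>i\<in>S. \<Sum>j\<in>S. v $ Inl i * A $ i $ j * v $ Inl j)" for v :: "real^('a + 'b)"
      using psd[THEN conjunct1, unfolded psd_on_def, THEN conjunct2, THEN spec[of _ "\<chi> i. v $ Inl i"]] by simp
    moreover have "0 \<le> (\<Sum>i\<in>T. \<Sum>j\<in>T. v $ Inr i * B $ i $ j * v $ Inr j)" for v :: "real^('a + 'b)"
      using psd[THEN conjunct2, unfolded psd_on_def, THEN conjunct2, THEN spec[of _ "\<chi> i. v $ Inr i"]] by simp
    ultimately show "psd_on (S <+> T) (block A 0 0 B)"
      using psd sym unfolding psd_on_def form by (simp add: add_nonneg_nonneg)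
  qed
qed

text \<open>
  Dehomogenisation: a vector with nonzero leading entry can be scaled to leading entry \<open>1\<close>, and on
  vectors with leading entry \<open>0\<close> the form is that of \<open>M\<close>.
\<close>

lemma psd_on_bordered:
  fixes M :: "real^'m^'m" and s :: "real^'m"
  assumes "psd_on J M"
  shows "psd_on (UNIV <+> J) (bordered \<rho> s M) \<longleftrightarrow>
    (\<forall>y. 0 \<le> \<rho> + 2 * (\<Sum>j\<in>J. s $ j * y $ j) + (\<Sum>i\<in>J. \<Sum>j\<in>J. y $ i * M $ i $ j * y $ j))"
proof -
  have form: "(\<Sum>i\<in>UNIV <+> J. \<Sum>j\<in>UNIV <+> J. v $ i * bordered \<rho> s M $ i $ j * v $ j)
      = (v $ Inl 1)\<^sup>2 * \<rho> + 2 * v $ Inl 1 * (\<Sum>j\<in>J. s $ j * v $ Inr j)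
      + (\<Sum>i\<in>J. \<Sum>j\<in>J. v $ Inr i * M $ i $ j * v $ Inr j)" for v :: "real^(1 + 'm)"
    by (simp add: sum.Plus bordered_def block_def UNIV_1 mat_def rowvector_def columnvector_def
        sum.distrib sum_distrib_left power2_eq_square algebra_simps)
  have sym: "\<forall>i\<in>UNIV <+> J. \<forall>j\<in>UNIV <+> J. bordered \<rho> s M $ i $ j = bordered \<rho> s M $ j $ i"
    using assms by (auto simp: psd_on_def bordered_def block_def mat_def rowvector_def columnvector_def)
  show ?thesis
  proof
    assume "psd_on (UNIV <+> J) (bordered \<rho> s M)"
    then have nonneg: "0 \<le> (v $ Inl 1)\<^sup>2 * \<rho> + 2 * v $ Inl 1 * (\<Sum>j\<in>J. s $ j * v $ Inr j)
      + (\<Sum>i\<in>J. \<Sum>j\<in>J. v $ Inr i * M $ i $ j * v $ Inr j)" for v :: "real^(1 + 'm)"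
      unfolding psd_on_def form by blast
    show "\<forall>y. 0 \<le> \<rho> + 2 * (\<Sum>j\<in>J. s $ j * y $ j) + (\<Sum>i\<in>J. \<Sum>j\<in>J. y $ i * M $ i $ j * y $ j)"
    proof
      show "0 \<le> \<rho> + 2 * (\<Sum>j\<in>J. s $ j * y $ j) + (\<Sum>i\<in>J. \<Sum>j\<in>J. y $ i * M $ i $ j * y $ j)" for y
        using nonneg[of "vpair 1 y"] by (simp add: vpair_def)
    qed
  next
    assume nonneg: "\<forall>y. 0 \<le> \<rho> + 2 * (\<Sum>j\<in>J. s $ j * y $ j) + (\<Sum>i\<in>J. \<Sum>j\<in>J. y $ i * M $ i $ j * y $ j)"
    have "0 \<le> (v $ Inl 1)\<^sup>2 * \<rho> + 2 * v $ Inl 1 * (\<Sum>j\<in>J. s $ j * v $ Inr j)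
      + (\<Sum>i\<in>J. \<Sum>j\<in>J. v $ Inr i * M $ i $ j * v $ Inr j)" (is "0 \<le> ?q")
      for v :: "real^(1 + 'm)"
    proof (cases "v $ Inl 1 = 0")
      case True
      then show ?thesis
        using assms[unfolded psd_on_def, THEN conjunct2, THEN spec[of _ "\<chi> i. v $ Inr i"]] by simp
    next
      case False
      let ?t = "v $ Inl 1"
      have "0 \<le> ?t\<^sup>2 * (\<rho> + 2 * (\<Sum>j\<in>J. s $ j * (v $ Inr j / ?t))
          + (\<Sum>i\<in>J. \<Sum>j\<in>J. v $ Inr i / ?t * M $ i $ j * (v $ Inr j / ?t)))"
        using nonneg[THEN spec[of _ "\<chi> i. v $ Inr i / ?t"]] by simp
      also have "\<dots> = ?q"
        using False by (simp add: distrib_left sum_distrib_left power2_eq_square) (simp add: mult.assoc mult.left_commute)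
      finally show ?thesis .
    qed
    then show "psd_on (UNIV <+> J) (bordered \<rho> s M)"
      using sym unfolding psd_on_def form by blast
  qed
qed

definition gen_cost :: "'n::finite network \<Rightarrow> real^('n + 'n) \<Rightarrow> real" where
  "gen_cost N y = (\<Sum>i\<in>gens N. Ccost N $ i $ i * (y $ Inl i)\<^sup>2 + ccost N $ i * y $ Inl i)"

text \<open>
  The Lagrangian below is that of \<open>(SDP)\<close> after eliminating \<open>Y\<close>: for given \<open>y\<close> the cost is least at
  \<open>Y = y y\<^sup>T\<close>, where it equals \<open>gen_cost N y\<close>. The constraint terms are the residuals priced
  by the multipliers; each inequality is oriented so that its residual is nonpositive at feasible
  points.
\<close>

definition constraint_terms ::
  "'n::finite network \<Rightarrow> 'n dual_vars \<Rightarrow> real^('n + 'n) \<Rightarrow> real^('n + 'n)^('n + 'n) \<Rightarrow> real" where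
  "constraint_terms N d y X =
     (\<Sum>r\<in>UNIV. phi d $ r * (A_bal N r \<bullet> X + a_bal N r \<bullet> y - b_bal N r))
     + (\<Sum>i\<in>UNIV. gam_ub d $ i * (X $ Inl i $ Inl i + X $ Inr i $ Inr i - vub N $ i)
                + gam_lb d $ i * (vlb N $ i - (X $ Inl i $ Inl i + X $ Inr i $ Inr i)))
     + (\<Sum>i\<in>gens N. thp_ub d $ i * (y $ Inl i - pub N $ i) + thp_lb d $ i * (plb N $ i - y $ Inl i)
                + thq_ub d $ i * (y $ Inr i - qub N $ i) + thq_lb d $ i * (qlb N $ i - y $ Inr i))"

definition lagrangian ::
  "'n::finite network \<Rightarrow> 'n dual_vars \<Rightarrow> real^('n + 'n) \<Rightarrow> real^('n + 'n)^('n + 'n) \<Rightarrow> real" where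
  "lagrangian N d y X = gen_cost N y + constraint_terms N d y X"

lemma sum_UNIV_Plus: "(\<Sum>r\<in>UNIV. f r) = (\<Sum>i\<in>UNIV. f (Inl i)) + (\<Sum>i\<in>UNIV. f (Inr i))"
  for f :: "'a::finite + 'b::finite \<Rightarrow> real"
  by (simp flip: UNIV_Plus_UNIV add: sum.Plus)

lemma diagm_inner: "diagm w \<bullet> X = (\<Sum>i\<in>UNIV. w $ i * X $ i $ i)"
  by (simp add: inner_vec_def diagm_def if_distrib[of "\<lambda>t. t * _"] cong: if_cong)

lemma penalty_inner:
  "penalty_matrix N \<phi> \<gamma>' \<bullet> X
     = (\<Sum>r\<in>UNIV. \<phi> $ r * (A_bal N r \<bullet> X)) + (\<Sum>i\<in>UNIV. \<gamma>' $ i * X $ i $ i)"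
  by (simp add: penalty_matrix_def inner_add_left inner_sum_left diagm_inner)

lemma transpose_A_bal: "transpose (A_bal N r) = A_bal N r"
  using A_bal_form_matrix[of N r] by (simp add: is_form_matrix_def)

lemma transpose_penalty: "transpose (penalty_matrix N \<phi> \<gamma>') = penalty_matrix N \<phi> \<gamma>'"
proof -
  have "A_bal N r $ i $ j = A_bal N r $ j $ i" for r i j
    using arg_cong[OF transpose_A_bal[of N r], of "\<lambda>M. M $ j $ i"] by (simp add: transpose_def)
  then show ?thesis
    by (simp add: transpose_def vec_eq_iff penalty_matrix_def diagm_def)
qed

lemma a_bal_inner: "a_bal N r \<bullet> y = (if r \<in> gen_idx N then y $ r else 0)"
  by (simp add: a_bal_def inner_axis')

lemma sum_gen_idx: "(\<Sum>r\<in>gen_idx N. f r) = (\<Sum>i\<in>gens N. f (Inl i) + f (Inr i))"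
  for f :: "_ \<Rightarrow> real"
  by (simp add: gen_idx_def sum.Plus sum.distrib)

lemma sum_a_bal: "(\<Sum>r\<in>UNIV. \<phi> $ r * (a_bal N r \<bullet> y)) = (\<Sum>i\<in>gens N. \<phi> $ Inl i * y $ Inl i + \<phi> $ Inr i * y $ Inr i)"
proof -
  have "(\<Sum>r\<in>UNIV. \<phi> $ r * (a_bal N r \<bullet> y)) = (\<Sum>r\<in>gen_idx N. \<phi> $ r * y $ r)"
    by (simp add: a_bal_inner if_distrib[of "\<lambda>t. _ * t"] sum.If_cases cong: if_cong)
  then show ?thesis by (simp add: sum_gen_idx)
qed

lemma dual_s_nth:
  assumes "i \<in> gens N"
  shows "dual_s N d $ Inl i = ccost N $ i + thp_ub d $ i - thp_lb d $ i + phi d $ Inl i"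
    and "dual_s N d $ Inr i = thq_ub d $ i - thq_lb d $ i + phi d $ Inr i"
proof -
  have "(\<Sum>r\<in>UNIV. phi d $ r *\<^sub>R a_bal N r) $ j = phi d $ j" if "j \<in> gen_idx N" for j
  proof -
    have "phi d $ r * a_bal N r $ j = (if r = j then phi d $ j else 0)" for r
      using that by (auto simp: a_bal_def axis_def)
    then show ?thesis by simp
  qed
  moreover have "Inl i \<in> gen_idx N" "Inr i \<in> gen_idx N"
    using assms by (auto simp: gen_idx_def)
  ultimately show "dual_s N d $ Inl i = ccost N $ i + thp_ub d $ i - thp_lb d $ i + phi d $ Inl i"
    and "dual_s N d $ Inr i = thq_ub d $ i - thq_lb d $ i + phi d $ Inr i"
    unfolding dual_s_def vector_add_component vector_minus_component by (simp_all add: vpair_def)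
qed

text \<open>
  Collecting the terms in \<open>X\<close> gives the penalty matrix, those linear in \<open>y\<close> give \<open>dual_s\<close>; the
  constants are the dual objective up to \<open>rho\<close>.
\<close>

lemma lagrangian_eq:
  "lagrangian N d y X = dual_obj N d + penalty_matrix N (phi d) (dual_gamma d) \<bullet> X
     + (rho d + (\<Sum>j\<in>gen_idx N. dual_s N d $ j * y $ j) + (\<Sum>i\<in>gens N. Ccost N $ i $ i * (y $ Inl i)\<^sup>2))"
proof -
  have 1: "(\<Sum>r\<in>UNIV. phi d $ r * (A_bal N r \<bullet> X + a_bal N r \<bullet> y - b_bal N r))
      = (\<Sum>r\<in>UNIV. phi d $ r * (A_bal N r \<bullet> X)) + (\<Sum>r\<in>UNIV. phi d $ r * (a_bal N r \<bullet> y))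
       - (\<Sum>r\<in>UNIV. phi d $ r * b_bal N r)"
    by (simp add: distrib_left right_diff_distrib sum.distrib sum_subtractf)
  have 2: "(\<Sum>i\<in>UNIV. gam_ub d $ i * (X $ Inl i $ Inl i + X $ Inr i $ Inr i - vub N $ i)
                + gam_lb d $ i * (vlb N $ i - (X $ Inl i $ Inl i + X $ Inr i $ Inr i)))
      = (\<Sum>i\<in>UNIV. dual_gamma d $ i * X $ i $ i)
        + (\<Sum>i\<in>UNIV. gam_lb d $ i * vlb N $ i - gam_ub d $ i * vub N $ i)"
    unfolding sum_UNIV_Plus sum.distrib[symmetric]
    by (intro sum.cong) (simp_all add: dual_gamma_def vpair_def algebra_simps)
  have 3: "(\<Sum>i\<in>gens N. Ccost N $ i $ i * (y $ Inl i)\<^sup>2 + ccost N $ i * y $ Inl i)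
      + (\<Sum>i\<in>gens N. phi d $ Inl i * y $ Inl i + phi d $ Inr i * y $ Inr i)
      + (\<Sum>i\<in>gens N. thp_ub d $ i * (y $ Inl i - pub N $ i) + thp_lb d $ i * (plb N $ i - y $ Inl i)
                + thq_ub d $ i * (y $ Inr i - qub N $ i) + thq_lb d $ i * (qlb N $ i - y $ Inr i))
      = (\<Sum>i\<in>gens N. thp_lb d $ i * plb N $ i + thq_lb d $ i * qlb N $ i
                - thp_ub d $ i * pub N $ i - thq_ub d $ i * qub N $ i)
      + (\<Sum>j\<in>gen_idx N. dual_s N d $ j * y $ j) + (\<Sum>i\<in>gens N. Ccost N $ i $ i * (y $ Inl i)\<^sup>2)"
    unfolding sum_gen_idx sum.distrib[symmetric]
    by (intro sum.cong) (simp_all add: dual_s_nth algebra_simps)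
  show ?thesis
    unfolding lagrangian_def gen_cost_def constraint_terms_def penalty_inner dual_obj_def 1 2 sum_a_bal
    using 3 by linarith
qed

lemma psd_on_dual_matrix:
  assumes "opf_network N"
  shows "psd_on ((UNIV <+> gen_idx N) <+> UNIV) (dual_matrix N d) \<longleftrightarrow>
    (\<forall>y. 0 \<le> rho d + (\<Sum>j\<in>gen_idx N. dual_s N d $ j * y $ j) + (\<Sum>i\<in>gens N. Ccost N $ i $ i * (y $ Inl i)\<^sup>2))
    \<and> psd (penalty_matrix N (phi d) (dual_gamma d))"
proof -
  let ?C = "block (Ccost N) 0 0 0 :: real^('a + 'a)^('a + 'a)"
  have C: "psd_on (gens N) (Ccost N)" "\<forall>i\<in>gens N. \<forall>j\<in>gens N. i \<noteq> j \<longrightarrow> Ccost N $ i $ j = 0"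
    using assms by (auto simp: opf_network_def)
  have psd: "psd_on (gen_idx N) ?C"
    using C(1) unfolding gen_idx_def psd_on_block_diagonal by (simp add: psd_on_def)
  have "(\<Sum>i\<in>gen_idx N. \<Sum>j\<in>gen_idx N. y $ i * ?C $ i $ j * y $ j)
      = (\<Sum>i\<in>gens N. Ccost N $ i $ i * (y $ Inl i)\<^sup>2)" for y
  proof -
    have "(\<Sum>j\<in>gens N. y $ Inl i * Ccost N $ i $ j * y $ Inl j) = Ccost N $ i $ i * (y $ Inl i)\<^sup>2"
      if "i \<in> gens N" for i
    proof -
      have "(\<Sum>j\<in>gens N. y $ Inl i * Ccost N $ i $ j * y $ Inl j)
          = (\<Sum>j\<in>gens N. if j = i then Ccost N $ i $ i * (y $ Inl i)\<^sup>2 else 0)"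
        using C(2) that by (intro sum.cong) (auto simp: power2_eq_square)
      then show ?thesis using that by simp
    qed
    then show ?thesis by (simp add: gen_idx_def sum.Plus block_def)
  qed
  moreover have "2 * (\<Sum>j\<in>gen_idx N. ((1/2) *\<^sub>R dual_s N d) $ j * y $ j)
      = (\<Sum>j\<in>gen_idx N. dual_s N d $ j * y $ j)" for y
    by (simp add: sum_distrib_left)
  ultimately show ?thesis
    unfolding dual_matrix_def psd_on_block_diagonal psd_on_bordered[OF psd] by presburger
qed

text \<open>
  The semidefinite constraint of \<open>(D)\<close> says exactly that the Lagrangian is bounded below by the dual
  objective. By the separated form of the Lagrangian, its block in \<open>X\<close> must be nonnegative on the
  whole cone and its quadratic part in \<open>y\<close> nonnegative everywhere.
\<close>

lemma dual_feasible_iff: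
  fixes N :: "'n::finite network"
  assumes "opf_network N"
  shows "d \<in> dual_feasible N \<longleftrightarrow>
     (\<forall>i. 0 \<le> gam_ub d $ i \<and> 0 \<le> gam_lb d $ i) \<and>
     (\<forall>i\<in>gens N. 0 \<le> thp_ub d $ i \<and> 0 \<le> thp_lb d $ i \<and> 0 \<le> thq_ub d $ i \<and> 0 \<le> thq_lb d $ i) \<and>
     (\<forall>y X. psd X \<longrightarrow> dual_obj N d \<le> lagrangian N d y X)"
proof -
  let ?M = "penalty_matrix N (phi d) (dual_gamma d)"
  define q where "q y = rho d + (\<Sum>j\<in>gen_idx N. dual_s N d $ j * y $ j)
      + (\<Sum>i\<in>gens N. Ccost N $ i $ i * (y $ Inl i)\<^sup>2)" for y :: "real^('n + 'n)"
  have L: "lagrangian N d y X = dual_obj N d + ?M \<bullet> X + q y" for y X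
    by (simp add: lagrangian_eq q_def)
  have iff: "(\<forall>y. 0 \<le> q y) \<and> psd ?M \<longleftrightarrow> (\<forall>y X. psd X \<longrightarrow> dual_obj N d \<le> lagrangian N d y X)"
  proof
    assume "(\<forall>y. 0 \<le> q y) \<and> psd ?M"
    then show "\<forall>y X. psd X \<longrightarrow> dual_obj N d \<le> lagrangian N d y X"
      using psd_inner_nonneg[of ?M] by (simp add: L add_nonneg_nonneg)
  next
    assume bound: "\<forall>y X. psd X \<longrightarrow> dual_obj N d \<le> lagrangian N d y X"
    have "0 \<le> q y" for y
      using bound[rule_format, of 0 y] by (simp add: L psd_on_def)
    moreover have "0 \<le> v \<bullet> (?M *v v)" for v
    proof (rule ccontr)
      assume neg: "\<not> 0 \<le> v \<bullet> (?M *v v)"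
      \<comment> \<open>Large enough that \<open>X = k v v\<^sup>T\<close> pushes the Lagrangian below the bound by \<open>1\<close>.\<close>
      define k where "k = (q 0 + 1) / (- (v \<bullet> (?M *v v)))"
      have "k \<ge> 0" using neg \<open>0 \<le> q 0\<close> by (simp add: k_def divide_nonneg_neg)
      have "outer (sqrt k *\<^sub>R v) = k *\<^sub>R outer v"
        using \<open>k \<ge> 0\<close> by (simp add: vec_eq_iff)
      then have "psd (k *\<^sub>R outer v)" using psd_outer[of "sqrt k *\<^sub>R v"] by simp
      then have "0 \<le> k * (v \<bullet> (?M *v v)) + q 0"
        using bound[rule_format, of "k *\<^sub>R outer v" 0] by (simp add: L inner_outer)
      moreover have "k * (v \<bullet> (?M *v v)) = - (q 0 + 1)"
        using neg by (simp add: k_def)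
      ultimately show False by simp
    qed
    ultimately show "(\<forall>y. 0 \<le> q y) \<and> psd ?M"
      by (simp add: psd_iff transpose_penalty)
  qed
  show ?thesis
    by (simp only: dual_feasible_def mem_Collect_eq psd_on_dual_matrix[OF assms] iff[unfolded q_def])
qed


section \<open>Bounds for the relaxation from dual and primal points\<close>

text \<open>
  Weak duality: the nonnegative multipliers price the bounds that \<open>z\<close> and \<open>y\<close> satisfy, and the
  remaining quadratic term in \<open>x\<close> is nonnegative by dual feasibility.
\<close>

lemma dual_obj_le_relaxation:
  assumes net: "opf_network N" and d: "d \<in> dual_feasible N" and xyz: "(x, y, z) \<in> relax_feasible N"
  shows "dual_obj N d \<le> h_obj N (phi d) (dual_gamma d) x y z"
proof -
  let ?M = "penalty_matrix N (phi d) (dual_gamma d)"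
  have sgn: "0 \<le> gam_ub d $ i" "0 \<le> gam_lb d $ i" for i
    using d unfolding dual_feasible_def mem_Collect_eq by blast+
  have sgn': "0 \<le> thp_ub d $ i" "0 \<le> thp_lb d $ i" "0 \<le> thq_ub d $ i" "0 \<le> thq_lb d $ i" if "i \<in> gens N" for i
    using d that unfolding dual_feasible_def mem_Collect_eq by blast+
  have psd: "psd ?M"
    using d by (simp only: dual_feasible_def mem_Collect_eq psd_on_dual_matrix[OF net])
  have v: "vlb N $ i \<le> z $ Inl i + z $ Inr i" "z $ Inl i + z $ Inr i \<le> vub N $ i" for i
    using xyz by (auto simp: relax_feasible_def)
  have pb: "power_bounds N y"
    using xyz by (simp add: relax_feasible_def)
  have "dual_obj N d \<le> lagrangian N d y 0"
    using d unfolding dual_feasible_iff[OF net] by (simp add: psd_on_def)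
  also have "\<dots> \<le> gen_cost N y + (\<Sum>r\<in>UNIV. phi d $ r * (a_bal N r \<bullet> y - b_bal N r)) - dual_gamma d \<bullet> z"
  proof -
    have "(\<Sum>i\<in>gens N. thp_ub d $ i * (y $ Inl i - pub N $ i) + thp_lb d $ i * (plb N $ i - y $ Inl i)
                + thq_ub d $ i * (y $ Inr i - qub N $ i) + thq_lb d $ i * (qlb N $ i - y $ Inr i)) \<le> 0"
      using pb sgn' by (intro sum_nonpos add_nonpos_nonpos mult_nonneg_nonpos) (auto simp: power_bounds_def)
    moreover have "(\<Sum>i\<in>UNIV. gam_ub d $ i * (- vub N $ i) + gam_lb d $ i * vlb N $ i) \<le> - (dual_gamma d \<bullet> z)"
    proof -
      have "gam_ub d $ i * (- vub N $ i) + gam_lb d $ i * vlb N $ i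
          \<le> - (dual_gamma d $ Inl i * z $ Inl i) - dual_gamma d $ Inr i * z $ Inr i" for i
        using mult_left_mono[OF v(1)[of i] sgn(2)[of i]] mult_left_mono[OF v(2)[of i] sgn(1)[of i]]
        by (simp add: dual_gamma_def vpair_def algebra_simps)
      then show ?thesis
        unfolding inner_vec_def sum_UNIV_Plus minus_add_distrib sum_negf[symmetric] sum.distrib[symmetric]
        by (intro sum_mono) simp
    qed
    ultimately show ?thesis by (simp add: lagrangian_def constraint_terms_def)
  qed
  also have "\<dots> \<le> h_obj N (phi d) (dual_gamma d) x y z"
    using psd by (simp add: h_obj_def gen_cost_def minner_eq_inner inner_outer psd_iff)
  finally show ?thesis .
qed

text \<open>
  A primal point of \<open>(SDP)\<close> is turned into a point of the relaxation by \<open>x = 0\<close> and \<open>z = diag X\<close>. The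
  penalty term then contributes \<open>-\<langle>M, X\<rangle> \<le> 0\<close> for every admissible penalty matrix \<open>M\<close>, so the bound
  is uniform in the parameters.
\<close>

lemma relaxation_value_le_primal:
  assumes net: "opf_network N" and M: "psd (penalty_matrix N \<phi> \<gamma>')"
    and eq: "\<And>r. A_bal N r \<bullet> X + a_bal N r \<bullet> y = b_bal N r"
    and vb: "\<And>i. vlb N $ i \<le> X $ Inl i $ Inl i + X $ Inr i $ Inr i"
      "\<And>i. X $ Inl i $ Inl i + X $ Inr i $ Inr i \<le> vub N $ i"
    and pb: "power_bounds N y" and X: "psd X"
  shows "relax_value N \<phi> \<gamma>' \<le> gen_cost N y"
proof -
  \<comment> \<open>With \<open>x = 0\<close> the term \<open>-\<lambda>\<^sub>r \<Sum>(x\<^sub>i\<^sup>2 - z\<^sub>i)\<close> becomes \<open>\<lambda>\<^sub>r tr X\<close>, a lower bound of \<open>\<langle>A\<^sub>r, X\<rangle>\<close>.\<close>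
  define z where "z = (\<chi> i. X $ i $ i)"
  have z: "0 \<le> z $ i" for i
    using psd_entries(1)[OF X] by (simp add: z_def)
  have zub: "z $ j \<le> u_bnd N $ j * u_bnd N $ j" for j
  proof (cases j)
    case (Inl i)
    then show ?thesis
      using vb(2)[of i] z[of "Inr i"] net by (simp add: u_bnd_def vpair_def z_def opf_network_def)
  next
    case (Inr i)
    then show ?thesis
      using vb(2)[of i] z[of "Inl i"] net by (simp add: u_bnd_def vpair_def z_def opf_network_def)
  qed
  have o: "outer (0 :: real^('a + 'a)) = 0" by (simp add: vec_eq_iff)
  have sz: "(\<Sum>i\<in>UNIV. z $ i) = (\<Sum>i\<in>UNIV. X $ i $ i)" by (simp add: z_def)
  have lam: "lambda_min (A_bal N r) * (\<Sum>i\<in>UNIV. z $ i) \<le> A_bal N r \<bullet> X" for r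
    unfolding sz by (rule lambda_min_trace_le_inner[OF transpose_A_bal X])
  have lam': "lambda_min (- A_bal N r) * (\<Sum>i\<in>UNIV. z $ i) \<le> - (A_bal N r \<bullet> X)" for r
  proof -
    have "transpose (- A_bal N r) = - A_bal N r"
      using transpose_A_bal[of N r] by (simp add: transpose_def vec_eq_iff)
    from lambda_min_trace_le_inner[OF this X] show ?thesis by (simp add: sz)
  qed
  have "a_bal N r \<bullet> y + lambda_min (A_bal N r) * (\<Sum>i\<in>UNIV. z $ i) \<le> b_bal N r"
    and "- (a_bal N r \<bullet> y) + lambda_min (- A_bal N r) * (\<Sum>i\<in>UNIV. z $ i) \<le> - b_bal N r" for r
    using eq[of r] lam[of r] lam'[of r] by linarith+
  then have "(0, y, z) \<in> relax_feasible N"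
    using pb vb z zub unfolding relax_feasible_def
    by (simp add: o minner_eq_inner l_bnd_def sum_negf) (simp add: z_def)
  then have "relax_value N \<phi> \<gamma>' \<le> h_obj N \<phi> \<gamma>' 0 y z"
    unfolding relax_value_def by (rule INF_lower2) simp
  also have "h_obj N \<phi> \<gamma>' 0 y z = gen_cost N y - penalty_matrix N \<phi> \<gamma>' \<bullet> X"
  proof -
    have "a_bal N r \<bullet> y - b_bal N r = - (A_bal N r \<bullet> X)" for r using eq[of r] by simp
    then show ?thesis
      by (simp add: h_obj_def gen_cost_def o minner_eq_inner penalty_inner inner_vec_def[of \<gamma>'] z_def sum_negf)
  qed
  also have "ereal \<dots> \<le> gen_cost N y" using psd_inner_nonneg[OF M X] by simp
  finally show ?thesis .
qed


section \<open>Strong duality\<close>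

text \<open>
  Components of \<open>y\<close> outside the generators carry no meaning; fixing them at \<open>0\<close> makes the
  sublevel sets below bounded.
\<close>

definition primal_domain :: "'n::finite network \<Rightarrow> ((real^('n + 'n)) \<times> (real^('n + 'n)^('n + 'n))) set" where
  "primal_domain N = {(y, X). psd X \<and> (\<forall>i. i \<notin> gens N \<longrightarrow> y $ Inl i = 0 \<and> y $ Inr i = 0)}"

type_synonym 'n ineq_index = "(('n + 'n) + (('n + 'n) + ('n + 'n))) option"

text \<open>
  The index \<open>None\<close> is the additional requirement that the cost be at most \<open>\<alpha>\<close>. A power bound at a
  node that is not a generator becomes the trivial inequality \<open>0 \<le> 0\<close>.
\<close>

fun ineq_residual ::
  "'n::finite network \<Rightarrow> real \<Rightarrow> 'n ineq_index \<Rightarrow>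
   (real^('n + 'n)) \<times> (real^('n + 'n)^('n + 'n)) \<Rightarrow> real" where
  "ineq_residual N \<alpha> None (y, X) = gen_cost N y - \<alpha>"
| "ineq_residual N \<alpha> (Some (Inl (Inl i))) (y, X) = X $ Inl i $ Inl i + X $ Inr i $ Inr i - vub N $ i"
| "ineq_residual N \<alpha> (Some (Inl (Inr i))) (y, X) = vlb N $ i - (X $ Inl i $ Inl i + X $ Inr i $ Inr i)"
| "ineq_residual N \<alpha> (Some (Inr (Inl (Inl i)))) (y, X) = (if i \<in> gens N then y $ Inl i - pub N $ i else 0)"
| "ineq_residual N \<alpha> (Some (Inr (Inl (Inr i)))) (y, X) = (if i \<in> gens N then plb N $ i - y $ Inl i else 0)"
| "ineq_residual N \<alpha> (Some (Inr (Inr (Inl i)))) (y, X) = (if i \<in> gens N then y $ Inr i - qub N $ i else 0)"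
| "ineq_residual N \<alpha> (Some (Inr (Inr (Inr i)))) (y, X) = (if i \<in> gens N then qlb N $ i - y $ Inr i else 0)"

lemma index_cases:
  obtains "k = None" | i where "k = Some (Inl (Inl i))" | i where "k = Some (Inl (Inr i))"
    | i where "k = Some (Inr (Inl (Inl i)))" | i where "k = Some (Inr (Inl (Inr i)))"
    | i where "k = Some (Inr (Inr (Inl i)))" | i where "k = Some (Inr (Inr (Inr i)))"
  by (metis option.exhaust sum.exhaust)

lemma psd_iff_outer: "psd X \<longleftrightarrow> transpose X = X \<and> (\<forall>v. 0 \<le> X \<bullet> outer v)"
  by (simp add: psd_iff inner_outer)

lemma closed_primal_domain: "closed (primal_domain N)"
proof -
  have "primal_domain N = {p. transpose (snd p) = snd p} \<inter> (\<Inter>v. {p. 0 \<le> snd p \<bullet> outer v})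
      \<inter> (\<Inter>i\<in>- gens N. {p. fst p $ Inl i = 0} \<inter> {p. fst p $ Inr i = 0})"
    by (auto simp: primal_domain_def psd_iff_outer)
  moreover have "closed {p :: (real^('a + 'a)) \<times> (real^('a + 'a)^('a + 'a)). transpose (snd p) = snd p}"
    unfolding transpose_def by (intro closed_Collect_eq continuous_intros)
  ultimately show ?thesis
    by (auto intro!: closed_Int closed_INT closed_Collect_le closed_Collect_eq continuous_intros)
qed

lemma convex_primal_domain: "convex (primal_domain N)"
  unfolding convex_def primal_domain_def psd_iff_outer
  by (auto simp: inner_add_left transpose_def vec_eq_iff)

lemma convex_on_ineq_residual:
  assumes "opf_network N" "convex S"
  shows "convex_on S (ineq_residual N \<alpha> k)"
proof (rule convex_onI[OF _ assms(2)])
  fix t :: real and p p' :: "(real^('a + 'a)) \<times> (real^('a + 'a)^('a + 'a))"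
  assume t: "0 < t" "t < 1"
  obtain y X y' X' where p: "p = (y, X)" "p' = (y', X')" by fastforce
  show "ineq_residual N \<alpha> k ((1 - t) *\<^sub>R p + t *\<^sub>R p')
      \<le> (1 - t) * ineq_residual N \<alpha> k p + t * ineq_residual N \<alpha> k p'"
  proof (cases k rule: index_cases)
    case 1
    have "Ccost N $ i $ i * ((1 - t) * y $ Inl i + t * y' $ Inl i)\<^sup>2
        + ccost N $ i * ((1 - t) * y $ Inl i + t * y' $ Inl i)
        \<le> (1 - t) * (Ccost N $ i $ i * (y $ Inl i)\<^sup>2 + ccost N $ i * y $ Inl i)
        + t * (Ccost N $ i $ i * (y' $ Inl i)\<^sup>2 + ccost N $ i * y' $ Inl i)" if i: "i \<in> gens N" for i
    proof -
      have "0 \<le> (\<Sum>j\<in>gens N. \<Sum>k\<in>gens N. axis i 1 $ j * Ccost N $ j $ k * axis i 1 $ k)"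
        using assms(1) unfolding opf_network_def psd_on_def by blast
      also have "\<dots> = Ccost N $ i $ i"
        using i by (simp add: axis_def if_distrib[of "\<lambda>t. _ * t"] if_distrib[of "\<lambda>t. t * _"] cong: if_cong)
      finally have "0 \<le> Ccost N $ i $ i * (t * (1 - t) * (y $ Inl i - y' $ Inl i)\<^sup>2)"
        using t by simp
      then show ?thesis by (simp add: power2_eq_square algebra_simps)
    qed
    then have "gen_cost N ((1 - t) *\<^sub>R y + t *\<^sub>R y') \<le> (1 - t) * gen_cost N y + t * gen_cost N y'"
      unfolding gen_cost_def sum_distrib_left sum.distrib[symmetric] by (intro sum_mono) simp
    then show ?thesis by (simp add: 1 p algebra_simps)
  qed (simp_all add: p algebra_simps)
qed

lemma continuous_on_ineq_residual: "continuous_on S (ineq_residual N \<alpha> k)"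
proof -
  have "continuous_on S (\<lambda>p. ineq_residual N \<alpha> k (fst p, snd p))"
  proof (cases k rule: index_cases)
    case 1
    then show ?thesis by (simp add: gen_cost_def del: prod.collapse) (intro continuous_intros)
  next
    case (2 i)
    then show ?thesis by (simp del: prod.collapse) (intro continuous_intros)
  next
    case (3 i)
    then show ?thesis by (simp del: prod.collapse) (intro continuous_intros)
  next
    case (4 i)
    then show ?thesis
      by (cases "i \<in> gens N"; simp del: prod.collapse; intro continuous_intros)
  next
    case (5 i)
    then show ?thesis
      by (cases "i \<in> gens N"; simp del: prod.collapse; intro continuous_intros)
  next
    case (6 i)
    then show ?thesis
      by (cases "i \<in> gens N"; simp del: prod.collapse; intro continuous_intros)
  next
    case (7 i)
    then show ?thesis
      by (cases "i \<in> gens N"; simp del: prod.collapse; intro continuous_intros)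
  qed
  then show ?thesis by simp
qed

lemma bounded_vec:
  fixes S :: "('a::real_normed_vector^'m) set"
  assumes "\<And>v j. v \<in> S \<Longrightarrow> norm (v $ j) \<le> B j"
  shows "bounded S"
proof -
  have "norm v \<le> (\<Sum>j\<in>UNIV. B j)" if "v \<in> S" for v
  proof -
    have "norm v \<le> (\<Sum>j\<in>UNIV. norm (v $ j))"
      unfolding norm_vec_def by (rule L2_set_le_sum) simp
    also have "\<dots> \<le> (\<Sum>j\<in>UNIV. B j)" using assms[OF that] by (rule sum_mono)
    finally show ?thesis .
  qed
  then show ?thesis unfolding bounded_iff by blast
qed

text \<open>
  The power bounds confine \<open>y\<close>. The voltage bounds confine the diagonal of \<open>X\<close>, and therefore all of
  its entries, since \<open>X\<close> is positive semidefinite.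
\<close>

lemma bounded_residual_sublevel:
  "bounded {p \<in> primal_domain N. \<forall>k. ineq_residual N \<alpha> k p \<le> 1}" (is "bounded ?S")
proof -
  define c where "c = (\<Sum>i\<in>UNIV. \<bar>vub N $ i\<bar>) + 1"
  have "bounded (fst ` ?S)"
  proof (rule bounded_vec)
    fix y j
    assume "y \<in> fst ` ?S"
    then obtain X where yX: "(y, X) \<in> primal_domain N" "\<And>k. ineq_residual N \<alpha> k (y, X) \<le> 1" by auto
    show "norm (y $ j) \<le> (case j of Inl i \<Rightarrow> \<bar>plb N $ i\<bar> + \<bar>pub N $ i\<bar> + 1 | Inr i \<Rightarrow> \<bar>qlb N $ i\<bar> + \<bar>qub N $ i\<bar> + 1)"
    proof (cases j)
      case (Inl i)
      then show ?thesis
        using yX(1) yX(2)[of "Some (Inr (Inl (Inl i)))"] yX(2)[of "Some (Inr (Inl (Inr i)))"]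
        by (cases "i \<in> gens N") (auto simp: primal_domain_def)
    next
      case (Inr i)
      then show ?thesis
        using yX(1) yX(2)[of "Some (Inr (Inr (Inl i)))"] yX(2)[of "Some (Inr (Inr (Inr i)))"]
        by (cases "i \<in> gens N") (auto simp: primal_domain_def)
    qed
  qed
  moreover have "bounded (snd ` ?S)"
  proof (rule bounded_vec)
    fix X j
    assume "X \<in> snd ` ?S"
    then obtain y where "(y, X) \<in> primal_domain N" and res: "\<And>k. ineq_residual N \<alpha> k (y, X) \<le> 1" by auto
    then have X: "psd X" by (simp add: primal_domain_def)
    have diag: "X $ l $ l \<le> c" for l
    proof -
      have v: "X $ Inl i $ Inl i + X $ Inr i $ Inr i \<le> c" for i
        using res[of "Some (Inl (Inl i))"] member_le_sum[of i UNIV "\<lambda>i. \<bar>vub N $ i\<bar>"]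
        by (simp add: c_def)
      show ?thesis
      proof (cases l)
        case (Inl i) then show ?thesis using v[of i] psd_entries(1)[OF X, of "Inr i"] by simp
      next
        case (Inr i) then show ?thesis using v[of i] psd_entries(1)[OF X, of "Inl i"] by simp
      qed
    qed
    have c: "0 \<le> c" by (simp add: c_def sum_nonneg)
    have "\<bar>X $ j $ l\<bar> \<le> c" for l
    proof (rule power2_le_imp_le)
      have "(X $ j $ l)\<^sup>2 \<le> X $ j $ j * X $ l $ l" by (rule psd_entries(2)[OF X])
      also have "\<dots> \<le> c * c" by (intro mult_mono diag psd_entries(1)[OF X] c)
      finally show "\<bar>X $ j $ l\<bar>\<^sup>2 \<le> c\<^sup>2" by (simp add: power2_eq_square)
    qed (rule c)
    then have "(\<Sum>l\<in>UNIV. \<bar>X $ j $ l\<bar>) \<le> (\<Sum>l\<in>(UNIV :: ('a + 'a) set). c)" by (intro sum_mono)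
    then show "norm (X $ j) \<le> (\<Sum>l\<in>(UNIV :: ('a + 'a) set). c)"
      using norm_le_l1_cart[of "X $ j"] by simp
  qed
  ultimately have "bounded (fst ` ?S \<times> snd ` ?S)" by (rule bounded_Times)
  then show ?thesis by (rule bounded_subset) (auto intro: rev_image_eqI)
qed

lemma sum_UNIV_option: "(\<Sum>k\<in>UNIV. f k) = f None + (\<Sum>k\<in>UNIV. f (Some k))"
  for f :: "'k::finite option \<Rightarrow> real"
  by (simp add: UNIV_option_conv sum.reindex)

definition multipliers ::
  "real^('n ineq_index) \<Rightarrow> real^('n + 'n) \<Rightarrow> 'n::finite dual_vars" where
  "multipliers \<mu> \<phi> = \<lparr>phi = \<phi>,
     gam_ub = (\<chi> i. \<mu> $ Some (Inl (Inl i))), gam_lb = (\<chi> i. \<mu> $ Some (Inl (Inr i))),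
     thp_ub = (\<chi> i. \<mu> $ Some (Inr (Inl (Inl i)))), thp_lb = (\<chi> i. \<mu> $ Some (Inr (Inl (Inr i)))),
     thq_ub = (\<chi> i. \<mu> $ Some (Inr (Inr (Inl i)))), thq_lb = (\<chi> i. \<mu> $ Some (Inr (Inr (Inr i)))),
     rho = 0\<rparr>"

lemma residual_combination:
  "(\<Sum>k\<in>UNIV. \<mu> $ k * ineq_residual N \<alpha> k (y, X))
     + (\<Sum>r\<in>UNIV. \<phi> $ r * (A_bal N r \<bullet> X + a_bal N r \<bullet> y - b_bal N r))
   = \<mu> $ None * (gen_cost N y - \<alpha>) + constraint_terms N (multipliers \<mu> \<phi>) y X"
proof -
  have gens: "(\<Sum>i\<in>UNIV. c i * (if i \<in> gens N then f i else 0)) = (\<Sum>i\<in>gens N. c i * f i)"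
    for c f :: "'a \<Rightarrow> real"
    by (simp add: if_distrib[of "\<lambda>t. _ * t"] sum.If_cases cong: if_cong)
  show ?thesis
    unfolding constraint_terms_def sum_UNIV_option sum_UNIV_Plus ineq_residual.simps gens sum.distrib
    by (simp add: multipliers_def)
qed

definition average_multipliers :: "real \<Rightarrow> 'n::finite dual_vars \<Rightarrow> 'n dual_vars \<Rightarrow> 'n dual_vars" where
  "average_multipliers u d m = \<lparr>phi = u *\<^sub>R (phi d + phi m),
     gam_ub = u *\<^sub>R (gam_ub d + gam_ub m), gam_lb = u *\<^sub>R (gam_lb d + gam_lb m),
     thp_ub = u *\<^sub>R (thp_ub d + thp_ub m), thp_lb = u *\<^sub>R (thp_lb d + thp_lb m),
     thq_ub = u *\<^sub>R (thq_ub d + thq_ub m), thq_lb = u *\<^sub>R (thq_lb d + thq_lb m), rho = 0\<rparr>"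

lemma constraint_terms_average:
  "constraint_terms N (average_multipliers u d m) y X
     = u * (constraint_terms N d y X + constraint_terms N m y X)"
proof -
  have s: "u * ((a + b + c) + (a' + b' + c')) = u * (a + a') + u * (b + b') + u * (c + c')" for a b c a' b' c' :: real
    by (simp add: algebra_simps)
  show ?thesis
    unfolding constraint_terms_def s sum.distrib[symmetric] sum_distrib_left
    by (intro arg_cong2[of _ _ _ _ "(+)"] sum.cong)
      (simp_all add: average_multipliers_def algebra_simps)
qed

text \<open>
  Strong duality. If no feasible point had cost at most the dual optimum \<open>\<alpha>\<close>, the theorem of the
  alternative would supply multipliers for the constraints together with a weight \<open>t \<ge> 0\<close> for the cost.
  Averaging these with the optimal \<open>d\<close> gives a dual feasible point of objective
  \<open>\<alpha> + \<delta> / (1 + t) > \<alpha>\<close>. The averaging also covers \<open>t = 0\<close>, where the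
  multipliers certify that the primal is infeasible.
\<close>

lemma dual_optimal_attained_by_primal:
  fixes N :: "'n::finite network"
  assumes net: "opf_network N" and opt: "dual_optimal N d"
  obtains X y where "\<And>r. A_bal N r \<bullet> X + a_bal N r \<bullet> y = b_bal N r"
    "\<And>i. vlb N $ i \<le> X $ Inl i $ Inl i + X $ Inr i $ Inr i"
    "\<And>i. X $ Inl i $ Inl i + X $ Inr i $ Inr i \<le> vub N $ i"
    "power_bounds N y" "psd X" "gen_cost N y \<le> dual_obj N d"
proof -
  let ?\<alpha> = "dual_obj N d"
  have d: "d \<in> dual_feasible N" and best: "\<And>d'. d' \<in> dual_feasible N \<Longrightarrow> dual_obj N d' \<le> ?\<alpha>"
    using opt by (auto simp: dual_optimal_def is_arg_max_linorder)
  have "\<exists>p\<in>primal_domain N. (\<forall>k. ineq_residual N ?\<alpha> k p \<le> 0)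
      \<and> (\<forall>r. A_bal N r \<bullet> snd p + a_bal N r \<bullet> fst p = b_bal N r)"
  proof (rule ccontr)
    assume none: "\<not> ?thesis"
    have "(0, 0) \<in> primal_domain N" by (simp add: primal_domain_def psd_on_def)
    then have ne: "primal_domain N \<noteq> {}" by blast
    have bdd: "bounded {p \<in> primal_domain N. (\<forall>k. ineq_residual N ?\<alpha> k p \<le> 1)
        \<and> (\<forall>r. \<bar>A_bal N r \<bullet> snd p + a_bal N r \<bullet> fst p - b_bal N r\<bar> \<le> 1)}"
      by (rule bounded_subset[OF bounded_residual_sublevel[of N ?\<alpha>]]) blast
    have lin: "linear (\<lambda>p. A_bal N r \<bullet> snd p + a_bal N r \<bullet> fst p)" for r
      by (rule linearI) (simp_all add: inner_add_right algebra_simps)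
    obtain \<mu> \<phi> \<delta> where \<mu>: "\<And>k. 0 \<le> \<mu> $ k" and \<delta>: "0 < \<delta>"
      and sep: "\<And>p. p \<in> primal_domain N \<Longrightarrow>
        \<delta> \<le> (\<Sum>k\<in>UNIV. \<mu> $ k * ineq_residual N ?\<alpha> k p)
          + (\<Sum>r\<in>UNIV. \<phi> $ r * (A_bal N r \<bullet> snd p + a_bal N r \<bullet> fst p - b_bal N r))"
      by (rule convex_system_alternative[OF ne closed_primal_domain convex_primal_domain
          convex_on_ineq_residual[OF net convex_primal_domain] continuous_on_ineq_residual lin bdd none])
        (rule that; blast)
    \<comment> \<open>The multiplier \<open>t\<close> of the cost may vanish. Adding \<open>d\<close>, whose cost has weight \<open>1\<close>, makes the
      total weight \<open>1 + t\<close> positive, and dividing by it yields proper dual variables.\<close>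
    define t u where "t = \<mu> $ None" and "u = 1 / (1 + t)"
    have t: "0 \<le> t" and u: "0 < u" using \<mu>[of None] by (simp_all add: t_def u_def)
    define m where "m = multipliers \<mu> \<phi>"
    define V where "V = ?\<alpha> + u * \<delta>"
    define d0 where "d0 = average_multipliers u d m"
    \<comment> \<open>\<open>\<rho>\<close> enters the dual objective with coefficient \<open>-1\<close> and the Lagrangian not at all, so it can be
      chosen to make the objective equal to the lower bound \<open>V\<close>.\<close>
    define d' where "d' = d0\<lparr>rho := dual_obj N d0 - V\<rparr>"
    have obj: "dual_obj N d' = V"
      by (simp add: d'_def dual_obj_def d0_def average_multipliers_def)
    have lag0: "V \<le> lagrangian N d' y X" if yX: "(y, X) \<in> primal_domain N" for y X
    proof -
      have terms: "constraint_terms N d' y X = u * (constraint_terms N d y X + constraint_terms N m y X)"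
        using constraint_terms_average[of N u d m y X] by (simp add: d'_def d0_def constraint_terms_def)
      have "?\<alpha> \<le> gen_cost N y + constraint_terms N d y X"
        using d yX unfolding dual_feasible_iff[OF net] lagrangian_def by (simp add: primal_domain_def)
      moreover have "\<delta> \<le> t * (gen_cost N y - ?\<alpha>) + constraint_terms N m y X"
        using sep[OF yX] by (simp add: residual_combination t_def m_def)
      ultimately have "(1 + t) * ?\<alpha> + \<delta> \<le> (1 + t) * gen_cost N y + (constraint_terms N d y X + constraint_terms N m y X)"
        by (simp add: algebra_simps)
      then have "u * ((1 + t) * ?\<alpha> + \<delta>)
          \<le> u * ((1 + t) * gen_cost N y + (constraint_terms N d y X + constraint_terms N m y X))"
        using u by (intro mult_left_mono) auto
      moreover have "u * ((1 + t) * a + b) = a + u * b" for a b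
        using t by (simp add: u_def field_simps)
      ultimately show ?thesis by (simp add: V_def lagrangian_def terms)
    qed
    have "V \<le> lagrangian N d' y X" if "psd X" for y X
    proof -
      define y' where "y' = (\<chi> j. if j \<in> gen_idx N then y $ j else 0)"
      have "lagrangian N d' y X = lagrangian N d' y' X"
        by (auto simp: lagrangian_eq y'_def gen_idx_def intro!: sum.cong)
      moreover have "(y', X) \<in> primal_domain N"
        using that by (auto simp: primal_domain_def y'_def gen_idx_def)
      ultimately show ?thesis using lag0 by simp
    qed
    moreover have "0 \<le> gam_ub d' $ i" "0 \<le> gam_lb d' $ i" for i
      using d \<mu> u unfolding dual_feasible_iff[OF net]
      by (simp_all add: d'_def d0_def average_multipliers_def m_def multipliers_def)
    moreover have "0 \<le> thp_ub d' $ i" "0 \<le> thp_lb d' $ i" "0 \<le> thq_ub d' $ i" "0 \<le> thq_lb d' $ i"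
      if "i \<in> gens N" for i
      using d \<mu> u that unfolding dual_feasible_iff[OF net]
      by (simp_all add: d'_def d0_def average_multipliers_def m_def multipliers_def)
    ultimately have "d' \<in> dual_feasible N" unfolding dual_feasible_iff[OF net] obj by blast
    then show False using best[of d'] obj u \<delta> by (simp add: V_def mult_le_0_iff)
  qed
  then obtain y X where yX: "(y, X) \<in> primal_domain N" and res: "\<And>k. ineq_residual N ?\<alpha> k (y, X) \<le> 0"
    and eq: "\<And>r. A_bal N r \<bullet> X + a_bal N r \<bullet> y = b_bal N r" by auto
  show thesis
  proof
    show "power_bounds N y"
      unfolding power_bounds_def
    proof
      fix i assume "i \<in> gens N"
      then show "plb N $ i \<le> y $ Inl i \<and> y $ Inl i \<le> pub N $ i \<and> qlb N $ i \<le> y $ Inr i \<and> y $ Inr i \<le> qub N $ i"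
        using res[of "Some (Inr (Inl (Inl i)))"] res[of "Some (Inr (Inl (Inr i)))"]
          res[of "Some (Inr (Inr (Inl i)))"] res[of "Some (Inr (Inr (Inr i)))"] by simp
    qed
    show "vlb N $ i \<le> X $ Inl i $ Inl i + X $ Inr i $ Inr i" for i using res[of "Some (Inl (Inr i))"] by simp
    show "X $ Inl i $ Inl i + X $ Inr i $ Inr i \<le> vub N $ i" for i using res[of "Some (Inl (Inl i))"] by simp
    show "gen_cost N y \<le> ?\<alpha>" using res[of None] by simp
    show "psd X" using yX by (simp add: primal_domain_def)
  qed (rule eq)
qed


section \<open>Optimal parameters\<close>

theorem corollary1:
  fixes N :: "'n::finite network" and d :: "'n dual_vars"
  assumes "opf_network N"
    and "dual_optimal N d"
  shows "P_optimal N
           (phi d, vpair (gam_ub d - gam_lb d) (gam_ub d - gam_lb d))"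
proof -
  have d: "d \<in> dual_feasible N" using assms(2) by (simp add: dual_optimal_def is_arg_max_def)
  obtain y X where primal: "\<And>r. A_bal N r \<bullet> X + a_bal N r \<bullet> y = b_bal N r"
    "\<And>i. vlb N $ i \<le> X $ Inl i $ Inl i + X $ Inr i $ Inr i"
    "\<And>i. X $ Inl i $ Inl i + X $ Inr i $ Inr i \<le> vub N $ i"
    "power_bounds N y" "psd X" and cost: "gen_cost N y \<le> dual_obj N d"
    by (rule dual_optimal_attained_by_primal[OF assms]) (rule that; blast)
  have "(phi d, dual_gamma d) \<in> P_feasible N"
    using d unfolding P_feasible_def dual_feasible_def mem_Collect_eq psd_on_dual_matrix[OF assms(1)]
    by (auto simp: dual_gamma_def)
  moreover have "relax_value N \<phi> \<gamma>' \<le> relax_value N (phi d) (dual_gamma d)" if "(\<phi>, \<gamma>') \<in> P_feasible N" for \<phi> \<gamma>'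
  proof -
    have "psd (penalty_matrix N \<phi> \<gamma>')" using that by (simp add: P_feasible_def)
    then have "relax_value N \<phi> \<gamma>' \<le> gen_cost N y"
      by (rule relaxation_value_le_primal[OF assms(1) _ primal])
    also have "\<dots> \<le> dual_obj N d" using cost by simp
    also have "\<dots> \<le> relax_value N (phi d) (dual_gamma d)"
      unfolding relax_value_def
      by (rule INF_greatest) (auto intro!: dual_obj_le_relaxation[OF assms(1) d])
    finally show ?thesis .
  qed
  ultimately have "P_optimal N (phi d, dual_gamma d)"
    by (auto simp: P_optimal_def is_arg_max_linorder)
  then show ?thesis by (simp add: dual_gamma_def)
qed

end
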